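(* (State-feedback stabilization with approximate kernels.) Let $\tau>h>0$, $\eta=\tau-h$, $f\in C^1(\mathcal T_1)$, $c\in\underline C$, and let $K,L,J$ be the exact control kernels. There exists $\varepsilon^*>0$ such that for every $\varepsilon\in(0,\varepsilon^* )$ and all continuous functions $\hat K$ on $\mathcal T_1$, $\hat L$ on $[0,h]$, $\hat J$ on $[0,\eta]$ (e.g. DeepONet outputs as in Theorem 4) with $\sup_{q\in[0,1]}|K(0,q)-\hat K(0,q)|\le\varepsilon$, $\sup_{\phi\in[0,h]}|L(\phi)-\hat L(\phi)|\le\varepsilon$, $\sup_{\sigma\in[0,\eta]}|J(\sigma)-\hat J(\sigma)|\le\varepsilon$, there exist $W_0>0$ and $\alpha_0>0$ such that every solution of the plant in closed loop with $$U(t)=\int_0^1\hat K(0,q)x(q,t)dq+h\int_0^1\hat L(hr)v(r,t)dr+\eta\int_0^1\hat J(\eta r)u(r,t)dr$$ satisfies, for all $t>0$ and all initial data $x_0,v_0,u_0\in L^2(0,1)$, $$\|x(\cdot,t)\|_{L^2}^2+\|v(\cdot,t)\|_{L^2}^2+\|u(\cdot,t)\|_{L^2}^2\le W_0e^{-\alpha_0t}\big(\|x_0\|_{L^2}^2+\|v_0\|_{L^2}^2+\|u_0\|_{L^2}^2\big).$$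
   Context: Notation: $\mathcal T_1=\{(s,q):0\le s\le q\le 1\}$; $\underline C=\{c\in C^1[0,1]:c(1)=0\}$; $\|g\|$ denotes the sup norm; $\|g\|_{L^2}^2=\int_0^1g^2(s)ds$. Plant: delays $\tau>h>0$ with $\eta:=\tau-h>0$; the PIDE $x_t(s,t)=-x_s(s,t)+c(s)x(1,t-\tau)+\int_s^1f(s,q)x(q,t)dq$, $x(0,t)=U(t)$, with measured output $y(t)=x(1,t-h)$, is written with transport states as: for $(s,t)\in(0,1)\times(0,\infty)$, $x_t=-x_s+c(s)u(0,t)+\int_s^1f(s,q)x(q,t)dq$, $x(0,t)=U(t)$; $hv_t=v_s$, $v(1,t)=x(1,t)$; $\eta u_t=u_s$, $u(1,t)=v(0,t)$; initial data $x(\cdot,0)=x_0$, $v(\cdot,0)=v_0$, $u(\cdot,0)=u_0$. Thus $y(t)=v(0,t)$. Control kernels: $K\in C^0(\mathcal T_1)$ is the unique continuous solution of $$K(s,q)=-\int_s^{s+1-q}f(\theta,\theta-s+q)\,d\theta+\int_s^{s+1-q}\!\int_\theta^{\theta-s+q}f(r,\theta-s+q)K(\theta,r)\,dr\,d\theta+\mathbf 1_{\{s+\tau<q\}}\Big(-c(s-q+1+\tau)+\int_{s-q+1+\tau}^1c(\theta)K(s-q+1+\tau,\theta)\,d\theta\Big),$$ (the characteristic form of $K_s+K_q=f(s,q)-\int_s^qK(s,r)f(r,q)dr$ with $K(s,1)=\int_{s+\tau}^1K(s+\tau,\theta)c(\theta)d\theta-c(s+\tau)$ if $s+\tau<1$,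 $K(s,1)=0$ otherwise); $J(\sigma)=\int_\sigma^1K(\sigma,q)c(q)dq-c(\sigma)$ for $0\le\sigma<1$, $J(\sigma)=0$ for $\sigma\ge1$; $L(\phi)=J(\phi+\eta)$ for $0\le\phi<1$, $L(\phi)=0$ for $\phi\ge1$. *)

theory Defs
  imports "HOL-Analysis.Analysis"
begin

definition T1 :: "(real \<times> real) set" where
  "T1 = {p. 0 \<le> fst p \<and> fst p \<le> snd p \<and> snd p \<le> 1}"

definition C1_on2 :: "(real \<times> real) set \<Rightarrow> (real \<Rightarrow> real \<Rightarrow> real) \<Rightarrow> bool" where
  "C1_on2 S g \<longleftrightarrow> (\<exists>D1 D2. continuous_on S D1 \<and> continuous_on S D2 \<and>
     (\<forall>p\<in>S. ((\<lambda>z. g (fst z) (snd z)) has_derivative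
               (\<lambda>z. D1 p * fst z + D2 p * snd z)) (at p within S)))"

definition C1_on01 :: "(real \<Rightarrow> real) \<Rightarrow> bool" where
  "C1_on01 g \<longleftrightarrow> (\<exists>D. continuous_on {0..1} D \<and>
     (\<forall>s\<in>{0..1}. (g has_real_derivative D s) (at s within {0..1})))"

definition C_under :: "(real \<Rightarrow> real) \<Rightarrow> bool" where
  "C_under c \<longleftrightarrow> C1_on01 c \<and> c 1 = 0"

definition L2_01 :: "(real \<Rightarrow> real) \<Rightarrow> bool" where
  "L2_01 g \<longleftrightarrow> set_borel_measurable lborel {0..1} g \<and>
                 set_integrable lborel {0..1} (\<lambda>s. (g s)\<^sup>2)"

definition L2norm2 :: "(real \<Rightarrow> real) \<Rightarrow> real" where
  "L2norm2 g = (LBINT s:{0..1}. (g s)\<^sup>2)"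

text \<open>K is a continuous solution on T_1 of the kernel integral equation
  (characteristic form of the kernel PDE); by the paper this solution is unique.\<close>
definition kernel_K :: "real \<Rightarrow> (real \<Rightarrow> real \<Rightarrow> real) \<Rightarrow> (real \<Rightarrow> real)
                        \<Rightarrow> (real \<Rightarrow> real \<Rightarrow> real) \<Rightarrow> bool" where
  "kernel_K \<tau> f c K \<longleftrightarrow>
     continuous_on T1 (\<lambda>p. K (fst p) (snd p)) \<and>
     (\<forall>s q. 0 \<le> s \<and> s \<le> q \<and> q \<le> 1 \<longrightarrow>
        K s q = - (LBINT \<theta>:{s..s+1-q}. f \<theta> (\<theta> - s + q))
                + (LBINT \<theta>:{s..s+1-q}. (LBINT r:{\<theta>..\<theta>-s+q}. f r (\<theta> - s + q) * K \<theta> r))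
                + (if s + \<tau> < q then
                     - c (s - q + 1 + \<tau>)
                     + (LBINT \<theta>:{s - q + 1 + \<tau>..1}. c \<theta> * K (s - q + 1 + \<tau>) \<theta>)
                   else 0))"

definition kernel_J :: "(real \<Rightarrow> real) \<Rightarrow> (real \<Rightarrow> real \<Rightarrow> real) \<Rightarrow> real \<Rightarrow> real" where
  "kernel_J c K \<sigma> = (if \<sigma> < 1 then (LBINT q:{\<sigma>..1}. K \<sigma> q * c q) - c \<sigma> else 0)"

definition kernel_L :: "real \<Rightarrow> real \<Rightarrow> (real \<Rightarrow> real) \<Rightarrow> (real \<Rightarrow> real \<Rightarrow> real) \<Rightarrow> real \<Rightarrow> real" where
  "kernel_L h \<tau> c K \<phi> = (if \<phi> < 1 then kernel_J c K (\<phi> + (\<tau> - h)) else 0)"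

definition state_regular :: "(real \<Rightarrow> real \<Rightarrow> real) \<Rightarrow> bool" where
  "state_regular z \<longleftrightarrow>
     (\<forall>t\<ge>0. L2_01 (\<lambda>s. z s t)) \<and>
     (\<forall>T\<ge>0. set_borel_measurable lborel ({0..1} \<times> {0..T}) (\<lambda>p. z (fst p) (snd p)) \<and>
             set_integrable lborel ({0..1} \<times> {0..T}) (\<lambda>p. (z (fst p) (snd p))\<^sup>2))"

definition feedback_U :: "real \<Rightarrow> real \<Rightarrow> (real \<Rightarrow> real \<Rightarrow> real) \<Rightarrow> (real \<Rightarrow> real) \<Rightarrow> (real \<Rightarrow> real)
     \<Rightarrow> (real \<Rightarrow> real \<Rightarrow> real) \<Rightarrow> (real \<Rightarrow> real \<Rightarrow> real) \<Rightarrow> (real \<Rightarrow> real \<Rightarrow> real) \<Rightarrow> real \<Rightarrow> real" where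
  "feedback_U h \<tau> Kh Lh Jh x v u t =
     (LBINT q:{0..1}. Kh 0 q * x q t)
     + h * (LBINT r:{0..1}. Lh (h * r) * v r t)
     + (\<tau> - h) * (LBINT r:{0..1}. Jh ((\<tau> - h) * r) * u r t)"

text \<open>(Mild) solution of the closed-loop system, written along characteristics:
  x_t = -x_s + c(s) u(0,t) + int_s^1 f(s,q) x(q,t) dq, x(0,t) = U(t);
  h v_t = v_s, v(1,t) = x(1,t); eta u_t = u_s, u(1,t) = v(0,t);
  x(.,0)=x0, v(.,0)=v0, u(.,0)=u0.\<close>
definition closed_loop_solution ::
  "real \<Rightarrow> real \<Rightarrow> (real \<Rightarrow> real \<Rightarrow> real) \<Rightarrow> (real \<Rightarrow> real)
   \<Rightarrow> (real \<Rightarrow> real \<Rightarrow> real) \<Rightarrow> (real \<Rightarrow> real) \<Rightarrow> (real \<Rightarrow> real)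
   \<Rightarrow> (real \<Rightarrow> real) \<Rightarrow> (real \<Rightarrow> real) \<Rightarrow> (real \<Rightarrow> real)
   \<Rightarrow> (real \<Rightarrow> real \<Rightarrow> real) \<Rightarrow> (real \<Rightarrow> real \<Rightarrow> real) \<Rightarrow> (real \<Rightarrow> real \<Rightarrow> real) \<Rightarrow> bool" where
  "closed_loop_solution h \<tau> f c Kh Lh Jh x0 v0 u0 x v u \<longleftrightarrow>
     (let \<eta> = \<tau> - h;
          U = feedback_U h \<tau> Kh Lh Jh x v u;
          G = (\<lambda>\<sigma> r. c \<sigma> * u 0 r + (LBINT q:{\<sigma>..1}. f \<sigma> q * x q r))
      in state_regular x \<and> state_regular v \<and> state_regular u \<and>
         (\<forall>T\<ge>0. set_integrable lborel {0..T} (\<lambda>r. (x 1 r)\<^sup>2) \<and>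
                 set_integrable lborel {0..T} (\<lambda>r. (v 0 r)\<^sup>2) \<and>
                 set_integrable lborel {0..T} (\<lambda>r. (u 0 r)\<^sup>2)) \<and>
         (\<forall>s\<in>{0..1}. \<forall>t\<ge>0.
            x s t = (if t \<le> s then x0 (s - t) + (LBINT r:{0..t}. G (s - t + r) r)
                     else U (t - s) + (LBINT r:{t - s..t}. G (s - t + r) r)) \<and>
            v s t = (if s + t / h \<le> 1 then v0 (s + t / h) else x 1 (t - h * (1 - s))) \<and>
            u s t = (if s + t / \<eta> \<le> 1 then u0 (s + t / \<eta>) else v 0 (t - \<eta> * (1 - s)))))"

end

theory Submission
  imports Defs
begin

text \<open>
  Let \<open>b\<close> be the trace \<open>u(0, \<cdot>)\<close>. The delay states are segments of \<open>b\<close>, since \<open>x(1, t) = b(t + \<tau>)\<close>, and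
  \<open>K\<close> is exactly such that the backstepping transform
  \<open>z(s, t) = x(s, t) - \<integral> K(s, q) x(q, t) dq - \<integral> J(s + \<sigma>) b(t + \<sigma>) d\<sigma>\<close> is constant along characteristics.
  As \<open>z(1, t) = x(1, t)\<close>, this gives \<open>z(s, t) = b(t + 1 + \<tau> - s)\<close>, so the squared L2 norm of the whole state
  at time \<open>t\<close> is equivalent to the integral of \<open>b\<^sup>2\<close> over the window \<open>[t, t + 1 + \<tau>]\<close> (the Volterra part is
  inverted by an exponentially weighted L1 estimate). At \<open>s = 0\<close> the transform equals the feedback
  error, hence \<open>|b(t + 1 + \<tau>)|\<close> is at most a multiple of \<open>\<epsilon>\<close> times the L1 norm of \<open>b\<close> over that window,
  and the window integrals of \<open>b\<^sup>2\<close> decay geometrically once \<open>\<epsilon>\<close> is small. As \<open>K\<close> is merely continuous,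
  the invariance of \<open>z\<close> is obtained by integrating along characteristics and exchanging integrals,
  without differentiating \<open>K\<close>.
\<close>

section \<open>Integrals over intervals\<close>

text \<open>With exact kernels the transform would vanish at the inlet \<open>s = 0\<close> for
  positive times, so \<open>b\<close> would be zero beyond time \<open>1 + \<tau>\<close>, the
  transit time through plant and delays. Approximate kernels only let a small multiple of one window
  leak into the next, so a contraction from window to window takes the place of a Lyapunov
  functional. The threshold on \<open>\<epsilon>\<close> must not depend on the solution; all
  constants behind it are therefore fixed in the locale of the plant. The two delay feedbacks form
  one integral, because L is J shifted by \<open>\<tau> - h\<close>: together they integrate J
  against \<open>b\<close> over \<open>[0, \<tau>]\<close>. The exchange of integrals acts on the
  formal derivative of K x along characteristics. Integrated along them it gives increments of K x;
  integrated across them it collapses by the kernel equation. Initial data need not be compatible.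
  The identities with \<open>b\<close> can fail at \<open>(s, t) = (1, 0)\<close> for x and at
  \<open>(0, 0)\<close> for v, which is why several estimates hold only off a null set.\<close>

lemma integral_shift:
  fixes g :: "real \<Rightarrow> real"
  shows "(LINT r|lborel. g (a + r)) = (LINT r|lborel. g r)"
  using lborel_integral_real_affine[of 1 g a] by simp

lemma integral_reflect:
  fixes g :: "real \<Rightarrow> real"
  shows "(LINT r|lborel. g (a - r)) = (LINT r|lborel. g r)"
  using lborel_integral_real_affine[of "-1" g a] by simp

lemma integrable_shift:
  fixes g :: "real \<Rightarrow> real"
  shows "integrable lborel (\<lambda>r. g (a + r)) \<longleftrightarrow> integrable lborel g"
  using lborel_integrable_real_affine_iff[of 1 g a] by simp

lemma integrable_reflect:
  fixes g :: "real \<Rightarrow> real"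
  shows "integrable lborel (\<lambda>r. g (a - r)) \<longleftrightarrow> integrable lborel g"
  using lborel_integrable_real_affine_iff[of "-1" g a] by simp

lemma integral_interval_affine:
  fixes g :: "real \<Rightarrow> real"
  assumes "0 < l"
  shows "(LINT \<sigma>|lborel. indicator {a..a + l} \<sigma> * g \<sigma>) = l * (LINT r|lborel. indicator {0..1} r * g (a + l * r))"
proof -
  have "a + l * r \<in> {a..a + l} \<longleftrightarrow> r \<in> {0..1}" for r
    using assms by (simp add: mult_le_cancel_left1 zero_le_mult_iff)
  then have ind: "indicator {a..a + l} (a + l * r) = (indicator {0..1} r :: real)" for r
    by (simp only: indicator_def)
  show ?thesis
    using lborel_integral_real_affine[of l "\<lambda>\<sigma>. indicator {a..a + l} \<sigma> * g \<sigma>" a] assms by (simp add: ind)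
qed

lemma integrable_indicator_Icc: "integrable lborel (indicator {a..b} :: real \<Rightarrow> real)"
  by (rule integrable_real_indicator) (auto simp: emeasure_lborel_Icc_eq)

lemma integrable_bounded_interval:
  fixes g :: "real \<Rightarrow> real"
  assumes "g \<in> borel_measurable lborel" and "\<And>r. \<bar>g r\<bar> \<le> C * indicator {a..b} r"
  shows "integrable lborel g"
proof (rule Bochner_Integration.integrable_bound)
  show "integrable lborel (\<lambda>r. C * indicator {a..b} r :: real)"
    by (intro integrable_mult_right integrable_indicator_Icc)
  show "AE r in lborel. norm (g r) \<le> norm (C * indicator {a..b} r :: real)"
    using assms(2) by (auto intro!: AE_I2 order.trans[OF _ abs_ge_self])
qed (use assms in auto)

lemma abs_integral_unit_interval_le:
  fixes g :: "real \<Rightarrow> real"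
  assumes "g \<in> borel_measurable lborel" and "\<And>r. \<bar>g r\<bar> \<le> C * indicator {0..1} r"
  shows "\<bar>LINT r|lborel. g r\<bar> \<le> C"
proof -
  have "\<bar>LINT r|lborel. g r\<bar> \<le> (LINT r|lborel. \<bar>g r\<bar>)"
    by (rule integral_abs_bound)
  also have "\<dots> \<le> (LINT r|lborel. C * indicator {0..1} (r::real))"
    using integrable_bounded_interval[OF assms] assms(2) by (intro integral_mono) auto
  finally show ?thesis by simp
qed

lemma integral_interval_combine:
  fixes g :: "real \<Rightarrow> real"
  assumes int: "\<And>a b. integrable lborel (\<lambda>r. indicator {a..b} r * g r)" and "a \<le> b" "b \<le> d"
  shows "(LINT r|lborel. indicator {a..b} r * g r) + (LINT r|lborel. indicator {b..d} r * g r)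
    = (LINT r|lborel. indicator {a..d} r * g r)"
proof -
  have "(LINT r|lborel. indicator {a..d} r * g r)
      = (LINT r|lborel. indicator {a..b} r * g r + indicator {b..d} r * g r)"
    by (rule integral_cong_AE[OF borel_measurable_integrable[OF int]
          borel_measurable_integrable[OF Bochner_Integration.integrable_add[OF int int]]],
        rule eventually_mono[OF AE_lborel_singleton[of b]])
       (use assms(2,3) in \<open>auto split: split_indicator\<close>)
  then show ?thesis using int by simp
qed

section \<open>Integration by parts for absolutely continuous functions, by Fubini\<close>

lemma integrable_times_primitive:
  fixes p q :: "real \<Rightarrow> real"
  assumes p: "integrable lborel p" and q: "integrable lborel q"
  shows "integrable lborel (\<lambda>r. p r * (LINT w|lborel. indicator {..r} w * q w))"
proof (rule Bochner_Integration.integrable_bound)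
  have [measurable]: "p \<in> borel_measurable borel" "q \<in> borel_measurable borel" using p q by auto
  show "integrable lborel (\<lambda>r. p r * (LINT w|lborel. \<bar>q w\<bar>))" using p by simp
  have "\<bar>LINT w|lborel. indicator {..r} w * q w\<bar> \<le> (LINT w|lborel. \<bar>q w\<bar>)" for r
    by (rule order.trans[OF integral_abs_bound])
       (use q in \<open>auto intro!: integral_mono integrable_mult_indicator[where 'b=real, simplified]
          simp: abs_mult split: split_indicator\<close>)
  then have "\<bar>p r\<bar> * \<bar>LINT w|lborel. indicator {..r} w * q w\<bar> \<le> \<bar>p r\<bar> * \<bar>LINT w|lborel. \<bar>q w\<bar>\<bar>" for r
    by (meson abs_ge_self abs_ge_zero mult_left_mono order_trans)
  then show "AE r in lborel. norm (p r * (LINT w|lborel. indicator {..r} w * q w))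
      \<le> norm (p r * (LINT w|lborel. \<bar>q w\<bar>))"
    by (simp add: abs_mult)
  show "(\<lambda>r. p r * (LINT w|lborel. indicator {..r} w * q w)) \<in> borel_measurable lborel"
    by (simp add: indicator_def atMost_def)
qed

text \<open>Fubini on the plane cut along its diagonal: the two terms are the integrals of the
  tensor product over \<open>w \<le> r\<close> and over \<open>r \<le> w\<close>.\<close>

lemma iterated_integral_triangles:
  fixes \<alpha> \<beta> :: "real \<Rightarrow> real"
  assumes \<alpha>: "integrable lborel \<alpha>" and \<beta>: "integrable lborel \<beta>"
  shows "(LINT r|lborel. \<alpha> r * (LINT w|lborel. indicator {..r} w * \<beta> w))
       + (LINT w|lborel. \<beta> w * (LINT r|lborel. indicator {..w} r * \<alpha> r))
       = (LINT r|lborel. \<alpha> r) * (LINT w|lborel. \<beta> w)"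
proof -
  have [measurable]: "\<alpha> \<in> borel_measurable borel" "\<beta> \<in> borel_measurable borel"
    using assms by auto
  have prod: "integrable (lborel \<Otimes>\<^sub>M lborel) (\<lambda>(r, w). \<alpha> r * \<beta> w)"
    by (rule lborel_pair.Fubini_integrable) (use assms in \<open>auto simp: abs_mult\<close>)
  let ?T = "\<lambda>r w. (if w \<le> r then \<alpha> r * \<beta> w else 0)"
  have T: "integrable (lborel \<Otimes>\<^sub>M lborel) (\<lambda>(r, w). ?T r w)"
    by (rule Bochner_Integration.integrable_bound[OF prod]) auto
  have T1: "(LINT w|lborel. ?T r w) = \<alpha> r * (LINT w|lborel. indicator {..r} w * \<beta> w)" for r
    unfolding integral_mult_right_zero[symmetric]
    by (intro Bochner_Integration.integral_cong) (auto split: split_indicator)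
  \<comment> \<open>The slice is the half-line from \<open>w\<close> upwards; it overlaps the
    complementary \<open>{..w}\<close> only at \<open>r = w\<close>, a null set.\<close>
  have T2: "(LINT r|lborel. ?T r w) = \<beta> w * (LINT r|lborel. \<alpha> r)
              - \<beta> w * (LINT r|lborel. indicator {..w} r * \<alpha> r)" for w
  proof -
    have i: "integrable lborel (\<lambda>r. indicator {..w} r * \<alpha> r)"
      by (rule Bochner_Integration.integrable_bound[OF \<alpha>]) (auto split: split_indicator)
    have "(LINT r|lborel. ?T r w) = (LINT r|lborel. \<beta> w * \<alpha> r - \<beta> w * (indicator {..w} r * \<alpha> r))"
      by (rule integral_cong_AE) (use AE_lborel_singleton[of w] in \<open>auto split: split_indicator elim!: eventually_mono\<close>)
    also have "\<dots> = \<beta> w * (LINT r|lborel. \<alpha> r) - \<beta> w * (LINT r|lborel. indicator {..w} r * \<alpha> r)"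
      using \<alpha> i by (subst Bochner_Integration.integral_diff) auto
    finally show ?thesis .
  qed
  have i2: "integrable lborel (\<lambda>w. \<beta> w * (LINT r|lborel. indicator {..w} r * \<alpha> r))"
    using integrable_times_primitive[OF \<beta> \<alpha>] .
  have "(LINT r|lborel. LINT w|lborel. ?T r w) = (LINT w|lborel. LINT r|lborel. ?T r w)"
    using lborel_pair.Fubini_integral[OF T] by simp
  then show ?thesis
    unfolding T1 T2 using \<beta> i2 by (subst (asm) Bochner_Integration.integral_diff) auto
qed

text \<open>Inserting both primitives leaves boundary terms and two triangle integrals, and the
  latter add up to the product of the total increments. Later \<open>k\<close> is the kernel and
  \<open>y\<close> the plant state along one characteristic.\<close>

lemma product_rule_absolutely_continuous:
  fixes k y k' g :: "real \<Rightarrow> real"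
  assumes k': "integrable lborel (\<lambda>r. indicator {0..m} r * k' r)"
    and g: "integrable lborel (\<lambda>r. indicator {0..m} r * g r)"
    and k: "\<And>r. 0 \<le> r \<Longrightarrow> r \<le> m \<Longrightarrow> k r = k 0 + (LINT w|lborel. indicator {0..r} w * k' w)"
    and y: "\<And>r. 0 \<le> r \<Longrightarrow> r \<le> m \<Longrightarrow> y r = y 0 + (LINT w|lborel. indicator {0..r} w * g w)"
    and m: "0 \<le> m"
  shows "k m * y m = k 0 * y 0 + (LINT r|lborel. indicator {0..m} r * (k' r * y r + k r * g r))"
proof -
  let ?\<alpha> = "\<lambda>r. indicator {0..m} r * k' r" and ?\<beta> = "\<lambda>r. indicator {0..m} r * g r"
  have sub: "(LINT w|lborel. indicator {..r} w * (indicator {0..m} w * p w))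
      = (LINT w|lborel. indicator {0..r} w * p w)" if "0 \<le> r" "r \<le> m" for r and p :: "real \<Rightarrow> real"
    using that by (intro Bochner_Integration.integral_cong) (auto split: split_indicator)
  let ?P = "\<lambda>r. ?\<alpha> r * (LINT w|lborel. indicator {..r} w * ?\<beta> w)"
  let ?Q = "\<lambda>r. ?\<beta> r * (LINT w|lborel. indicator {..r} w * ?\<alpha> w)"
  have P: "?\<alpha> r * y r = ?P r + y 0 * ?\<alpha> r" for r
    using y[of r] sub[of r g] by (auto simp: algebra_simps split: split_indicator)
  have Q: "?\<beta> r * k r = ?Q r + k 0 * ?\<beta> r" for r
    using k[of r] sub[of r k'] by (auto simp: algebra_simps split: split_indicator)
  have "(LINT r|lborel. indicator {0..m} r * (k' r * y r + k r * g r))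
      = (LINT r|lborel. (?P r + y 0 * ?\<alpha> r) + (?Q r + k 0 * ?\<beta> r))"
    unfolding P[symmetric] Q[symmetric] by (simp add: algebra_simps)
  also have "\<dots> = (LINT r|lborel. ?\<alpha> r) * (LINT r|lborel. ?\<beta> r)
      + y 0 * (LINT r|lborel. ?\<alpha> r) + k 0 * (LINT r|lborel. ?\<beta> r)"
    using k' g integrable_times_primitive[OF k' g] integrable_times_primitive[OF g k'] iterated_integral_triangles[OF k' g] by simp
  finally show ?thesis
    using k[of m] y[of m] m by (simp add: algebra_simps)
qed

text \<open>Absorption in a weighted L1 norm. Exchanging the integrals puts the primitive of the
  weight in front of \<open>\<bar>y\<bar>\<close>; the rate \<open>2 * \<kappa>\<close> makes that
  primitive at most the weight divided by \<open>2 * \<kappa>\<close>, so \<open>a\<close> costs at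
  most half of the weighted norm of \<open>y\<close>. The constant is 2 from the absorption times
  the largest value of the weight.\<close>

lemma volterra_L1_bound:
  fixes y a :: "real \<Rightarrow> real"
  assumes y: "integrable lborel y" and a: "a \<in> borel_measurable borel" and \<kappa>: "0 < \<kappa>"
    and y_out: "\<And>s. s \<notin> {0..1} \<Longrightarrow> y s = 0" and a_out: "\<And>s. s \<notin> {0..1} \<Longrightarrow> a s = 0"
    and le: "\<And>s. \<bar>a s\<bar> \<le> \<kappa> * (LINT q|lborel. indicator {s..} q * \<bar>y q\<bar>)"
  shows "(LINT s|lborel. \<bar>y s\<bar>) \<le> 2 * exp (2 * \<kappa>) * (LINT s|lborel. \<bar>y s - a s\<bar>)"
proof -
  note [measurable] = a borel_measurable_integrable[OF y]
  define e where "e s = indicator {0..1} s * exp (2 * \<kappa> * s)" for s :: real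
  have [measurable]: "e \<in> borel_measurable borel" unfolding e_def[abs_def] by measurable
  have e_nonneg: "0 \<le> e s" for s by (simp add: e_def)
  have e_le: "e s \<le> exp (2 * \<kappa>)" for s
    using \<kappa> mult_left_le[of s \<kappa>] by (auto simp: e_def split: split_indicator)
  have "\<bar>e s\<bar> \<le> exp (2 * \<kappa>) * indicator {0..1} s" for s
    using e_le[of s] by (cases "s \<in> {0..1}") (simp_all add: e_def)
  then have e_int: "integrable lborel e"
    by (intro integrable_bounded_interval) simp_all
  let ?Y = "LINT q|lborel. \<bar>y q\<bar>"
  have y_abs: "integrable lborel (\<lambda>q. \<bar>y q\<bar>)" using y by simp
  have y_part: "integrable lborel (\<lambda>q. indicator S q * \<bar>y q\<bar>)" if "S \<in> sets borel" for S
    using integrable_mult_indicator[OF _ y_abs, of S] that by simp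
  \<comment> \<open>The tail is traded for an initial segment, the form to which
    \<open>iterated_integral_triangles\<close> applies.\<close>
  have tail: "(LINT q|lborel. indicator {s..} q * \<bar>y q\<bar>) = ?Y - (LINT q|lborel. indicator {..s} q * \<bar>y q\<bar>)" for s
  proof -
    have "(LINT q|lborel. indicator {s..} q * \<bar>y q\<bar>) = (LINT q|lborel. \<bar>y q\<bar> - indicator {..s} q * \<bar>y q\<bar>)"
      by (rule integral_cong_AE, measurable, rule eventually_mono[OF AE_lborel_singleton[of s]])
         (auto split: split_indicator)
    then show ?thesis using y_abs y_part[of "{..s}"] by simp
  qed
  have primitive: "(LINT s|lborel. indicator {..r} s * e s) \<le> e r / (2 * \<kappa>)" if "r \<in> {0..1}" for r
  proof -
    have "(LINT s|lborel. exp (2 * \<kappa> * s) * indicator {0..r} s) = exp (2 * \<kappa> * r) / (2 * \<kappa>) - exp (2 * \<kappa> * 0) / (2 * \<kappa>)"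
      using that \<kappa> by (intro integral_FTC_Icc_real) (auto intro!: derivative_eq_intros continuous_intros)
    moreover have "(LINT s|lborel. indicator {..r} s * e s) = (LINT s|lborel. exp (2 * \<kappa> * s) * indicator {0..r} s)"
      by (rule Bochner_Integration.integral_cong) (use that in \<open>auto simp: e_def split: split_indicator\<close>)
    ultimately show ?thesis using that \<kappa> by (simp add: e_def)
  qed
  have weighted: "integrable lborel (\<lambda>s. e s * g s)" if "integrable lborel g" for g :: "real \<Rightarrow> real"
  proof (rule Bochner_Integration.integrable_bound[OF integrable_mult_right[OF that, of "exp (2 * \<kappa>)"]])
    show "(\<lambda>s. e s * g s) \<in> borel_measurable lborel" using that by measurable
    show "AE s in lborel. norm (e s * g s) \<le> norm (exp (2 * \<kappa>) * g s)"
      using e_le e_nonneg by (intro AE_I2) (auto simp: abs_mult intro!: mult_right_mono)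
  qed
  have "\<bar>a s\<bar> \<le> \<kappa> * ?Y * indicator {0..1} s" for s
  proof (cases "s \<in> {0..1}")
    case True
    have "\<bar>a s\<bar> \<le> \<kappa> * (?Y - (LINT q|lborel. indicator {..s} q * \<bar>y q\<bar>))" using le[of s] by (simp only: tail)
    also have "\<dots> \<le> \<kappa> * ?Y" using \<kappa> by (intro mult_left_mono) auto
    finally show ?thesis using True by simp
  qed (simp add: a_out)
  then have a_int: "integrable lborel a"
    using a by (intro integrable_bounded_interval[where C = "\<kappa> * ?Y" and a = 0 and b = 1]) auto
  let ?P = "LINT r|lborel. \<bar>y r\<bar> * (LINT s|lborel. indicator {..r} s * e s)"
  let ?Q = "LINT s|lborel. e s * (LINT r|lborel. indicator {..s} r * \<bar>y r\<bar>)"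
  have P_int: "integrable lborel (\<lambda>r. \<bar>y r\<bar> * (LINT s|lborel. indicator {..r} s * e s))"
    by (rule integrable_times_primitive[OF y_abs e_int])
  have Q_int: "integrable lborel (\<lambda>s. e s * (LINT r|lborel. indicator {..s} r * \<bar>y r\<bar>))"
    by (rule integrable_times_primitive[OF e_int y_abs])
  have "(LINT s|lborel. e s * \<bar>a s\<bar>) \<le> (LINT s|lborel. \<kappa> * (e s * ?Y - e s * (LINT r|lborel. indicator {..s} r * \<bar>y r\<bar>)))"
  proof (rule integral_mono)
    fix s
    have "e s * \<bar>a s\<bar> \<le> e s * (\<kappa> * (?Y - (LINT q|lborel. indicator {..s} q * \<bar>y q\<bar>)))"
      using le[of s] e_nonneg[of s] unfolding tail by (rule mult_left_mono)
    then show "e s * \<bar>a s\<bar> \<le> \<kappa> * (e s * ?Y - e s * (LINT r|lborel. indicator {..s} r * \<bar>y r\<bar>))"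
      by (simp add: algebra_simps)
  qed (use weighted a_int e_int Q_int in auto)
  also have "\<dots> = \<kappa> * ((LINT s|lborel. e s) * ?Y - ?Q)" using e_int Q_int by simp
  also have "\<dots> = \<kappa> * ?P"
    using iterated_integral_triangles[OF y_abs e_int] by (simp add: mult.commute)
  also have "?P \<le> (LINT r|lborel. e r * \<bar>y r\<bar> / (2 * \<kappa>))"
  proof (rule integral_mono[OF P_int])
    fix r show "\<bar>y r\<bar> * (LINT s|lborel. indicator {..r} s * e s) \<le> e r * \<bar>y r\<bar> / (2 * \<kappa>)"
    proof (cases "r \<in> {0..1}")
      case True
      show ?thesis using mult_left_mono[OF primitive[OF True] abs_ge_zero[of "y r"]] by (simp add: mult_ac)
    qed (simp add: y_out)
  qed (use weighted[OF y_abs] in auto)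
  finally have half: "(LINT s|lborel. e s * \<bar>a s\<bar>) \<le> (LINT s|lborel. e s * \<bar>y s\<bar>) / 2"
    using \<kappa> by (simp add: field_simps)
  have ya: "integrable lborel (\<lambda>s. \<bar>y s - a s\<bar>)" using y a_int by simp
  have "?Y \<le> (LINT s|lborel. e s * \<bar>y s\<bar>)"
  proof (rule integral_mono[OF y_abs weighted[OF y_abs]])
    fix s show "\<bar>y s\<bar> \<le> e s * \<bar>y s\<bar>"
    proof (cases "s \<in> {0..1}")
      case True
      then have "1 \<le> e s" using \<kappa> by (simp add: e_def)
      then show ?thesis using mult_right_mono[of 1 "e s" "\<bar>y s\<bar>"] by simp
    qed (simp add: y_out)
  qed
  also have "\<dots> \<le> 2 * (LINT s|lborel. e s * \<bar>y s - a s\<bar>)"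
  proof -
    have "(LINT s|lborel. e s * \<bar>y s\<bar>) \<le> (LINT s|lborel. e s * \<bar>y s - a s\<bar> + e s * \<bar>a s\<bar>)"
    proof (rule integral_mono)
      fix s show "e s * \<bar>y s\<bar> \<le> e s * \<bar>y s - a s\<bar> + e s * \<bar>a s\<bar>"
        unfolding distrib_left[symmetric] using e_nonneg by (intro mult_left_mono) auto
    qed (use weighted[OF y_abs] weighted[OF ya] weighted[of "\<lambda>s. \<bar>a s\<bar>"] a_int in auto)
    also have "\<dots> = (LINT s|lborel. e s * \<bar>y s - a s\<bar>) + (LINT s|lborel. e s * \<bar>a s\<bar>)"
      using weighted[OF ya] weighted[of "\<lambda>s. \<bar>a s\<bar>"] a_int by simp
    finally show ?thesis using half by simp
  qed
  also have "\<dots> \<le> 2 * (LINT s|lborel. exp (2 * \<kappa>) * \<bar>y s - a s\<bar>)"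
    by (intro mult_left_mono integral_mono mult_right_mono) (use weighted[OF ya] ya e_le in auto)
  finally show ?thesis by simp
qed

section \<open>Estimates on an interval and geometric decay\<close>

lemma cauchy_schwarz_interval:
  fixes g :: "real \<Rightarrow> real"
  assumes g: "integrable lborel (\<lambda>r. indicator {a..d} r * g r)"
    and g2: "integrable lborel (\<lambda>r. indicator {a..d} r * (g r)\<^sup>2)" and "a < d"
  shows "(LINT r|lborel. indicator {a..d} r * \<bar>g r\<bar>)\<^sup>2 \<le> (d - a) * (LINT r|lborel. indicator {a..d} r * (g r)\<^sup>2)"
proof -
  \<comment> \<open>The mean of \<open>\<bar>g\<bar>\<close>: nonnegativity of the integrated
    squared deviation from it is the claimed inequality.\<close>
  define m where "m = (LINT r|lborel. indicator {a..d} r * \<bar>g r\<bar>) / (d - a)"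
  have ga: "integrable lborel (\<lambda>r. indicator {a..d} r * \<bar>g r\<bar>)"
    using integrable_abs[OF g] by (simp add: abs_mult)
  have "0 \<le> (LINT r|lborel. indicator {a..d} r * (\<bar>g r\<bar> - m)\<^sup>2)" by simp
  also have "(\<lambda>r. indicator {a..d} r * (\<bar>g r\<bar> - m)\<^sup>2)
      = (\<lambda>r. indicator {a..d} r * (g r)\<^sup>2 - 2 * m * (indicator {a..d} r * \<bar>g r\<bar>) + m\<^sup>2 * indicator {a..d} r)"
    by (auto simp: fun_eq_iff power2_diff algebra_simps split: split_indicator)
  also have "(LINT r|lborel. indicator {a..d} r * (g r)\<^sup>2 - 2 * m * (indicator {a..d} r * \<bar>g r\<bar>) + m\<^sup>2 * indicator {a..d} r)
      = (LINT r|lborel. indicator {a..d} r * (g r)\<^sup>2) - 2 * m * (LINT r|lborel. indicator {a..d} r * \<bar>g r\<bar>) + m\<^sup>2 * (d - a)"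
    using g2 ga integrable_indicator_Icc[of a d] \<open>a < d\<close> by simp
  also have "\<dots> = (LINT r|lborel. indicator {a..d} r * (g r)\<^sup>2) - m\<^sup>2 * (d - a)"
    using \<open>a < d\<close> by (simp add: m_def power2_eq_square)
  finally have "m\<^sup>2 * (d - a) * (d - a) \<le> (LINT r|lborel. indicator {a..d} r * (g r)\<^sup>2) * (d - a)"
    using \<open>a < d\<close> by (intro mult_right_mono) auto
  then show ?thesis using \<open>a < d\<close> by (simp add: m_def power2_eq_square mult.commute)
qed

lemma integral_interval_perturbation:
  fixes p k k' :: "real \<Rightarrow> real"
  assumes k: "integrable lborel (\<lambda>r. indicator {a..d} r * (k r * p r))"
    and k': "integrable lborel (\<lambda>r. indicator {a..d} r * (k' r * p r))"
    and p: "integrable lborel (\<lambda>r. indicator {a..d} r * p r)"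
    and le: "\<And>r. r \<in> {a..d} \<Longrightarrow> \<bar>k' r - k r\<bar> \<le> \<epsilon>"
  shows "\<bar>(LINT r|lborel. indicator {a..d} r * (k' r * p r)) - (LINT r|lborel. indicator {a..d} r * (k r * p r))\<bar>
     \<le> \<epsilon> * (LINT r|lborel. indicator {a..d} r * \<bar>p r\<bar>)"
proof -
  have pa: "integrable lborel (\<lambda>r. indicator {a..d} r * \<bar>p r\<bar>)"
    using integrable_abs[OF p] by (simp add: abs_mult)
  have "\<bar>(LINT r|lborel. indicator {a..d} r * (k' r * p r)) - (LINT r|lborel. indicator {a..d} r * (k r * p r))\<bar>
      = \<bar>LINT r|lborel. indicator {a..d} r * (k' r * p r) - indicator {a..d} r * (k r * p r)\<bar>"
    using k k' by simp
  also have "\<dots> \<le> (LINT r|lborel. \<bar>indicator {a..d} r * (k' r * p r) - indicator {a..d} r * (k r * p r)\<bar>)"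
    by (rule integral_abs_bound)
  also have "\<dots> \<le> (LINT r|lborel. \<epsilon> * (indicator {a..d} r * \<bar>p r\<bar>))"
  proof (rule integral_mono)
    fix r
    have "\<bar>k' r * p r - k r * p r\<bar> \<le> \<epsilon> * \<bar>p r\<bar>" if "r \<in> {a..d}"
      using mult_right_mono[OF le[OF that] abs_ge_zero[of "p r"]]
      by (simp add: left_diff_distrib[symmetric] abs_mult)
    then show "\<bar>indicator {a..d} r * (k' r * p r) - indicator {a..d} r * (k r * p r)\<bar>
        \<le> \<epsilon> * (indicator {a..d} r * \<bar>p r\<bar>)"
      by (auto split: split_indicator)
  qed (use k k' pa in auto)
  finally show ?thesis by simp
qed

lemma integrable_continuous_times:
  fixes k p :: "real \<Rightarrow> real"
  assumes k: "continuous_on {a..d} k" and p: "integrable lborel (\<lambda>r. indicator {a..d} r * p r)"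
  shows "integrable lborel (\<lambda>r. indicator {a..d} r * (k r * p r))"
proof -
  obtain C where "\<forall>y\<in>k ` {a..d}. norm y \<le> C"
    using compact_imp_bounded[OF compact_continuous_image[OF k compact_Icc]] unfolding bounded_iff by blast
  then have C: "\<bar>k r\<bar> \<le> C" if "r \<in> {a..d}" for r using that by auto
  have km: "(\<lambda>r. indicator {a..d} r * k r) \<in> borel_measurable borel"
    using borel_measurable_continuous_on_indicator[OF _ k] by simp
  show ?thesis
  proof (rule Bochner_Integration.integrable_bound[OF integrable_mult_right[OF p, of C]])
    have "(\<lambda>r. (indicator {a..d} r * k r) * (indicator {a..d} r * p r)) \<in> borel_measurable lborel"
      using km borel_measurable_integrable[OF p] by measurable
    also have "(\<lambda>r. (indicator {a..d} r * k r) * (indicator {a..d} r * p r)) = (\<lambda>r. indicator {a..d} r * (k r * p r))"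
      by (auto simp: fun_eq_iff split: split_indicator)
    finally show "(\<lambda>r. indicator {a..d} r * (k r * p r)) \<in> borel_measurable lborel" .
    have "\<bar>k r * p r\<bar> \<le> \<bar>C * p r\<bar>" if "r \<in> {a..d}" for r
      using C[OF that] by (auto simp: abs_mult intro!: mult_right_mono)
    then show "AE r in lborel. norm (indicator {a..d} r * (k r * p r)) \<le> norm (C * (indicator {a..d} r * p r))"
      by (intro AE_I2) (auto split: split_indicator)
  qed
qed

text \<open>The factor 2 pays for rounding \<open>t / N\<close> down to an integer number of
  halvings.\<close>

lemma geometric_window_decay:
  fixes \<beta> :: "real \<Rightarrow> real"
  assumes N: "0 < N" and nonneg: "\<And>t. 0 \<le> \<beta> t"
    and half: "\<And>t. 0 \<le> t \<Longrightarrow> \<beta> (t + N) \<le> \<beta> t / 2"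
    and start: "\<And>r. 0 \<le> r \<Longrightarrow> r \<le> N \<Longrightarrow> \<beta> r \<le> C" and t: "0 \<le> t"
  shows "\<beta> t \<le> 2 * exp (- (ln 2 / N) * t) * C"
proof -
  define n where "n = nat \<lfloor>t / N\<rfloor>"
  define r where "r = t - real n * N"
  have n: "real n \<le> t / N" "t / N < real n + 1"
    using t N by (simp_all add: n_def)
  then have r: "0 \<le> r" "r \<le> N" using N by (simp_all add: r_def field_simps)
  have steps: "\<beta> (r + real k * N) \<le> (1 / 2) ^ k * C" for k
  proof (induction k)
    case (Suc k)
    have "\<beta> (r + real (Suc k) * N) = \<beta> ((r + real k * N) + N)" by (simp add: algebra_simps)
    also have "\<dots> \<le> \<beta> (r + real k * N) / 2" using r N by (intro half) auto
    finally show ?case using Suc by simp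
  qed (use start r in simp)
  have "\<beta> t \<le> (1 / 2) ^ n * C" using steps[of n] by (simp add: r_def)
  also have "\<dots> \<le> 2 * exp (- (ln 2 / N) * t) * C"
  proof (rule mult_right_mono)
    have e2: "exp (- ln 2) = (1 / 2 :: real)" unfolding exp_minus by simp
    have "(1 / 2 :: real) ^ n = exp (- (ln 2 * real n))"
      using exp_of_nat_mult[of n "- ln 2 :: real"] unfolding e2 by (simp add: mult.commute)
    also have "\<dots> \<le> exp (ln 2 - ln 2 * (t / N))"
    proof -
      have "ln 2 * (t / N) \<le> ln 2 * (real n + 1)" using n(2) by (intro mult_left_mono less_imp_le) simp_all
      then show ?thesis unfolding exp_le_cancel_iff distrib_left by linarith
    qed
    also have "ln 2 - ln 2 * (t / N) = ln 2 + (- (ln 2 / N) * t)" by simp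
    also have "exp \<dots> = 2 * exp (- (ln 2 / N) * t)" unfolding exp_add by simp
    finally show "(1 / 2) ^ n \<le> 2 * exp (- (ln 2 / N) * t)" .
    show "0 \<le> C" using order.trans[OF nonneg[of 0] start[of 0]] N by simp
  qed
  finally show ?thesis .
qed

text \<open>Bridge from L2 to L1 on bounded sets: solutions come with integrable squares, while the
  transform needs first powers.\<close>

lemma abs_le_one_plus_square: "\<bar>a\<bar> \<le> 1 + a\<^sup>2" for a :: real
proof (cases "\<bar>a\<bar> \<le> 1")
  case False
  then have "\<bar>a\<bar> * 1 \<le> \<bar>a\<bar> * \<bar>a\<bar>" by (intro mult_left_mono) auto
  then show ?thesis by (simp add: power2_eq_square)
qed (simp add: add_increasing2)

lemma sum_square_le: "\<bar>a\<bar> \<le> p + q \<Longrightarrow> a\<^sup>2 \<le> 2 * p\<^sup>2 + 2 * q\<^sup>2" for a p q :: real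
proof -
  assume "\<bar>a\<bar> \<le> p + q"
  then have "\<bar>a\<bar> \<le> \<bar>p + q\<bar>" by linarith
  then have "a\<^sup>2 \<le> (p + q)\<^sup>2" by (simp only: abs_le_square_iff)
  also have "\<dots> \<le> 2 * p\<^sup>2 + 2 * q\<^sup>2"
    using zero_le_power2[of "p - q"] by (simp add: power2_eq_square algebra_simps)
  finally show ?thesis .
qed

section \<open>The control kernels\<close>

lemma compact_T1: "compact T1"
proof -
  have "T1 = {p. 0 \<le> fst p} \<inter> {p. fst p \<le> snd p} \<inter> {p. snd p \<le> 1}"
    by (auto simp: T1_def)
  moreover have "closed \<dots>"
    by (intro closed_Int closed_Collect_le continuous_intros)
  moreover have "T1 \<subseteq> cbox (0, 0) (1, 1)"
    by (auto simp: T1_def cbox_Pair_eq)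
  ultimately show ?thesis
    by (metis bounded_cbox bounded_subset compact_eq_bounded_closed)
qed

lemma measurable_extension_T1:
  assumes "continuous_on T1 (\<lambda>p. g (fst p) (snd p) :: real)"
  shows "(\<lambda>p. indicator T1 p * g (fst p) (snd p)) \<in> borel_measurable (borel \<Otimes>\<^sub>M borel)"
  using borel_measurable_continuous_on_indicator[OF _ assms] compact_T1
  by (simp add: borel_prod compact_imp_closed)

text \<open>Turns joint measurability into a rule for curried terms, such as values along a
  characteristic.\<close>

lemma measurable_apply2:
  assumes "(\<lambda>p. g (fst p) (snd p) :: real) \<in> borel_measurable (borel \<Otimes>\<^sub>M borel)"
    and "a \<in> borel_measurable M" and "b \<in> borel_measurable M"
  shows "(\<lambda>x. g (a x :: real) (b x :: real)) \<in> borel_measurable M"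
proof -
  have "(\<lambda>x. (a x, b x)) \<in> measurable M (borel \<Otimes>\<^sub>M borel)" using assms by simp
  from measurable_compose[OF this assms(1)] show ?thesis by simp
qed

locale plant =
  fixes h \<tau> :: real and f K :: "real \<Rightarrow> real \<Rightarrow> real" and c :: "real \<Rightarrow> real"
  assumes h_pos: "0 < h" and h_less: "h < \<tau>"
    and f_cont: "continuous_on T1 (\<lambda>p. f (fst p) (snd p))"
    and c_cont: "continuous_on {0..1} c" and c_1: "c 1 = 0"
    and kernel: "kernel_K \<tau> f c K"
begin

text \<open>The data are extended by 0 outside their domains, so that no integral needs limits.\<close>

definition fT :: "real \<Rightarrow> real \<Rightarrow> real" where "fT s q = indicator T1 (s, q) * f s q"
definition KT :: "real \<Rightarrow> real \<Rightarrow> real" where "KT s q = indicator T1 (s, q) * K s q"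
definition cT :: "real \<Rightarrow> real" where "cT s = indicator {0..1} s * c s"
definition JT :: "real \<Rightarrow> real" where "JT \<sigma> = (LINT q|lborel. KT \<sigma> q * cT q) - cT \<sigma>"
text \<open>The right-hand side of the kernel equation \<open>K\<^sub>s + K\<^sub>q = F\<close>.\<close>

definition FT :: "real \<Rightarrow> real \<Rightarrow> real"
  where "FT s q = fT s q - (LINT r|lborel. KT s r * fT r q)"

lemma K_cont: "continuous_on T1 (\<lambda>p. K (fst p) (snd p))"
  using kernel by (simp add: kernel_K_def)

lemma fT_measurable_pair: "(\<lambda>p. fT (fst p) (snd p)) \<in> borel_measurable (borel \<Otimes>\<^sub>M borel)"
  using measurable_extension_T1[OF f_cont] by (simp add: fT_def)

lemma KT_measurable_pair: "(\<lambda>p. KT (fst p) (snd p)) \<in> borel_measurable (borel \<Otimes>\<^sub>M borel)"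
  using measurable_extension_T1[OF K_cont] by (simp add: KT_def)

lemmas fT_measurable[measurable (raw)] = measurable_apply2[where g = fT, OF fT_measurable_pair]
lemmas KT_measurable[measurable (raw)] = measurable_apply2[where g = KT, OF KT_measurable_pair]

lemma cT_measurable[measurable]: "cT \<in> borel_measurable borel"
  using borel_measurable_continuous_on_indicator[OF _ c_cont] by (simp add: cT_def[abs_def])

lemma FT_measurable_pair: "(\<lambda>p. FT (fst p) (snd p)) \<in> borel_measurable (borel \<Otimes>\<^sub>M borel)"
  unfolding FT_def by measurable

lemmas FT_measurable[measurable (raw)] = measurable_apply2[where g = FT, OF FT_measurable_pair]

lemma JT_measurable[measurable]: "JT \<in> borel_measurable borel"
  unfolding JT_def by measurable

lemma fT_outside: "(s, q) \<notin> T1 \<Longrightarrow> fT s q = 0" by (simp add: fT_def)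
lemma KT_outside: "(s, q) \<notin> T1 \<Longrightarrow> KT s q = 0" by (simp add: KT_def)

lemma FT_outside: "(s, q) \<notin> T1 \<Longrightarrow> FT s q = 0"
proof -
  assume a: "(s, q) \<notin> T1"
  have *: "KT s r * fT r q = 0" for r
    using a KT_outside[of s r] fT_outside[of r q] by (fastforce simp: T1_def)
  show ?thesis unfolding FT_def * using fT_outside[OF a] by simp
qed

section \<open>Uniform bounds on the data\<close>

lemma ex_kernel_bound: "\<exists>\<kappa>>0. \<forall>s q. \<bar>fT s q\<bar> \<le> \<kappa> \<and> \<bar>KT s q\<bar> \<le> \<kappa> \<and> \<bar>cT s\<bar> \<le> \<kappa>"
proof -
  have bdd: "\<exists>C\<ge>0. \<forall>p\<in>S. \<bar>g p\<bar> \<le> C"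
    if "compact S" "continuous_on S g" for S :: "'a::topological_space set" and g :: "'a \<Rightarrow> real"
  proof -
    from that have "bounded (g ` S)" by (intro compact_imp_bounded compact_continuous_image)
    then obtain B where "\<forall>x\<in>g ` S. norm x \<le> B" by (auto simp: bounded_iff)
    then show ?thesis by (intro exI[of _ "max 0 B"]) (auto simp: le_max_iff_disj)
  qed
  obtain A where A: "A \<ge> 0" "\<forall>p\<in>T1. \<bar>f (fst p) (snd p)\<bar> \<le> A"
    using bdd[OF compact_T1 f_cont] by blast
  obtain B where B: "B \<ge> 0" "\<forall>p\<in>T1. \<bar>K (fst p) (snd p)\<bar> \<le> B"
    using bdd[OF compact_T1 K_cont] by blast
  obtain C where C: "C \<ge> 0" "\<forall>s\<in>{0..1}. \<bar>c s\<bar> \<le> C"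
    using bdd[OF compact_Icc c_cont] by blast
  have "\<bar>fT s q\<bar> \<le> A + B + C + 1 \<and> \<bar>KT s q\<bar> \<le> A + B + C + 1 \<and> \<bar>cT s\<bar> \<le> A + B + C + 1" for s q
    using A(1) B(1) C(1) A(2)[rule_format, of "(s, q)"] B(2)[rule_format, of "(s, q)"] C(2)[rule_format, of s]
    by (auto simp: fT_def KT_def cT_def split: split_indicator)
  with A B C show ?thesis by (intro exI[of _ "A + B + C + 1"]) auto
qed

definition \<kappa> :: real
  where "\<kappa> = (SOME k. k > 0 \<and> (\<forall>s q. \<bar>fT s q\<bar> \<le> k \<and> \<bar>KT s q\<bar> \<le> k \<and> \<bar>cT s\<bar> \<le> k))"

lemma \<kappa>_bounds: "\<kappa> > 0" "\<bar>fT s q\<bar> \<le> \<kappa>" "\<bar>KT s q\<bar> \<le> \<kappa>" "\<bar>cT s\<bar> \<le> \<kappa>"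
  using someI_ex[OF ex_kernel_bound] unfolding \<kappa>_def by auto

lemma T1_abs_le_indicator: "\<bar>fT s q\<bar> \<le> \<kappa> * indicator {0..1} q" "\<bar>fT s q\<bar> \<le> \<kappa> * indicator {0..1} s"
  "\<bar>KT s q\<bar> \<le> \<kappa> * indicator {0..1} q" "\<bar>KT s q\<bar> \<le> \<kappa> * indicator {0..1} s"
  "\<bar>cT s\<bar> \<le> \<kappa> * indicator {0..1} s"
  using \<kappa>_bounds(1) \<kappa>_bounds(2,3)[of s q] \<kappa>_bounds(4)[of s] by (auto simp: fT_def KT_def cT_def T1_def split: split_indicator)

lemma KT_fT_le: "\<bar>KT s r * fT r' q\<bar> \<le> \<kappa> * \<kappa> * indicator {0..1} r"
  using mult_mono[OF T1_abs_le_indicator(3)[of s r] \<kappa>_bounds(2)[of r' q]] \<kappa>_bounds(1)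
  by (simp add: abs_mult mult_ac)

lemma KT_cT_le: "\<bar>KT s r * cT r'\<bar> \<le> \<kappa> * \<kappa> * indicator {0..1} r"
  using mult_mono[OF T1_abs_le_indicator(3)[of s r] \<kappa>_bounds(4)[of r']] \<kappa>_bounds(1)
  by (simp add: abs_mult mult_ac)

text \<open>Common bound of \<open>JT\<close> and \<open>FT\<close>: each is one datum of size at
  most \<open>\<kappa>\<close> combined with an integral over the unit interval of a product of two
  data.\<close>

definition \<mu> :: real where "\<mu> = \<kappa> * \<kappa> + \<kappa>"

lemma \<mu>_pos: "\<mu> > 0" using \<kappa>_bounds(1) by (simp add: \<mu>_def add_pos_pos)

lemma JT_le: "\<bar>JT \<sigma>\<bar> \<le> \<mu>"
proof -
  have "\<bar>LINT q|lborel. KT \<sigma> q * cT q\<bar> \<le> \<kappa> * \<kappa>"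
    by (rule abs_integral_unit_interval_le) (use KT_cT_le in auto)
  then show ?thesis using \<kappa>_bounds(4)[of \<sigma>] unfolding JT_def \<mu>_def by linarith
qed

lemma FT_le: "\<bar>FT s q\<bar> \<le> \<mu>"
proof -
  have "\<bar>LINT r|lborel. KT s r * fT r q\<bar> \<le> \<kappa> * \<kappa>"
    by (rule abs_integral_unit_interval_le) (use KT_fT_le in auto)
  then show ?thesis using \<kappa>_bounds(2)[of s q] unfolding FT_def \<mu>_def by linarith
qed

lemma kernel_J_eq_JT: "0 \<le> \<sigma> \<Longrightarrow> kernel_J c K \<sigma> = JT \<sigma>"
proof (cases "\<sigma> < 1")
  case True
  assume "0 \<le> \<sigma>"
  then have "(LBINT q:{\<sigma>..1}. K \<sigma> q * c q) = (LINT q|lborel. KT \<sigma> q * cT q)"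
    unfolding set_lebesgue_integral_def
    by (intro Bochner_Integration.integral_cong) (auto simp: KT_def cT_def T1_def split: split_indicator)
  then show ?thesis using True \<open>0 \<le> \<sigma>\<close> by (simp add: kernel_J_def JT_def cT_def)
next
  case False
  \<comment> \<open>For \<open>\<sigma> \<ge> 1\<close> the only pair in the triangle is
    \<open>\<sigma> = q = 1\<close>, where \<open>c 1 = 0\<close> removes the product. So the zero
    extension agrees with J at \<open>\<sigma> = 1\<close> as well.\<close>
  then have *: "KT \<sigma> q * cT q = 0" for q
    using c_1 by (cases "q = 1") (auto simp: KT_def cT_def T1_def split: split_indicator)
  have "cT \<sigma> = 0" using False c_1 by (cases "\<sigma> = 1") (auto simp: cT_def split: split_indicator)
  then show ?thesis using False unfolding kernel_J_def JT_def * by simp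
qed

lemma kernel_L_eq_JT: "0 \<le> \<phi> \<Longrightarrow> kernel_L h \<tau> c K \<phi> = JT (\<phi> + (\<tau> - h))"
  using h_less kernel_J_eq_JT[of "\<phi> + (\<tau> - h)"] by (auto simp: kernel_L_def kernel_J_def)

text \<open>The kernel equation read as an integral of \<open>FT\<close> from \<open>(s, q)\<close>
  along the diagonal direction up to the side \<open>q = 1\<close>. The supports of
  \<open>KT\<close> and \<open>fT\<close> reproduce the inner limits of integration.\<close>

lemma KT_characteristic:
  assumes "0 \<le> s" "s \<le> q" "q \<le> 1"
  shows "KT s q = JT (s - q + 1 + \<tau>) - (LINT r|lborel. indicator {0..1 - q} r * FT (s + r) (q + r))"
proof -
  let ?I = "\<lambda>\<theta>. indicator {s..s + 1 - q} \<theta> :: real"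
  let ?in = "\<lambda>\<theta>. (LINT r|lborel. KT \<theta> r * fT r (\<theta> - s + q))"
  have in_eq: "(LBINT r:{\<theta>..\<theta> - s + q}. f r (\<theta> - s + q) * K \<theta> r) = ?in \<theta>"
    if "s \<le> \<theta>" "\<theta> \<le> s + 1 - q" for \<theta>
    unfolding set_lebesgue_integral_def
    by (rule Bochner_Integration.integral_cong)
       (use that assms in \<open>auto simp: KT_def fT_def T1_def split: split_indicator\<close>)
  have e1: "(LBINT \<theta>:{s..s+1-q}. f \<theta> (\<theta> - s + q)) = (LINT \<theta>|lborel. ?I \<theta> * fT \<theta> (\<theta> - s + q))"
    unfolding set_lebesgue_integral_def
    by (rule Bochner_Integration.integral_cong)
       (use assms in \<open>auto simp: fT_def T1_def split: split_indicator\<close>)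
  have e2: "(LBINT \<theta>:{s..s+1-q}. (LBINT r:{\<theta>..\<theta>-s+q}. f r (\<theta> - s + q) * K \<theta> r))
      = (LINT \<theta>|lborel. ?I \<theta> * ?in \<theta>)"
    unfolding set_lebesgue_integral_def[of _ "{s..s+1-q}"]
    by (rule Bochner_Integration.integral_cong) (use in_eq in \<open>auto split: split_indicator\<close>)
  have i1: "integrable lborel (\<lambda>\<theta>. ?I \<theta> * fT \<theta> (\<theta> - s + q))"
    by (rule integrable_bounded_interval[where C = \<kappa>])
       (use \<kappa>_bounds in \<open>auto simp: abs_mult split: split_indicator\<close>)
  have "\<bar>?in \<theta>\<bar> \<le> \<kappa> * \<kappa>" for \<theta>
    by (rule abs_integral_unit_interval_le) (use KT_fT_le in auto)
  then have i2: "integrable lborel (\<lambda>\<theta>. ?I \<theta> * ?in \<theta>)"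
    by (intro integrable_bounded_interval[where C = "\<kappa> * \<kappa>"])
       (auto simp: abs_mult split: split_indicator)
  \<comment> \<open>The condition \<open>s + \<tau> < q\<close> says
    \<open>s - q + 1 + \<tau> < 1\<close>, which is the case distinction made in
    \<open>kernel_J\<close>.\<close>
  have "(if s + \<tau> < q then - c (s - q + 1 + \<tau>)
          + (LBINT \<theta>:{s - q + 1 + \<tau>..1}. c \<theta> * K (s - q + 1 + \<tau>) \<theta>) else 0) = kernel_J c K (s - q + 1 + \<tau>)"
    by (simp add: kernel_J_def mult.commute)
  also have "\<dots> = JT (s - q + 1 + \<tau>)"
    using assms h_pos h_less by (intro kernel_J_eq_JT) auto
  finally have "K s q = JT (s - q + 1 + \<tau>) - (LINT \<theta>|lborel. ?I \<theta> * fT \<theta> (\<theta> - s + q)) + (LINT \<theta>|lborel. ?I \<theta> * ?in \<theta>)"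
    using kernel assms unfolding kernel_K_def e1[symmetric] e2[symmetric] by simp
  also have "\<dots> = JT (s - q + 1 + \<tau>) - (LINT \<theta>|lborel. ?I \<theta> * FT \<theta> (\<theta> - s + q))"
    using i1 i2 by (simp add: FT_def right_diff_distrib)
  also have "(LINT \<theta>|lborel. ?I \<theta> * FT \<theta> (\<theta> - s + q)) = (LINT r|lborel. ?I (s + r) * FT (s + r) (s + r - s + q))"
    by (rule integral_shift[symmetric])
  also have "\<dots> = (LINT r|lborel. indicator {0..1 - q} r * FT (s + r) (q + r))"
    by (intro Bochner_Integration.integral_cong) (auto simp: add.commute split: split_indicator)
  finally show ?thesis using assms by (simp add: KT_def T1_def)
qed

text \<open>The characteristic has length zero here, so only the boundary term survives. This value
  later converts outflow of x at \<open>s = 1\<close> into a delay term.\<close>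

lemma KT_right_boundary:
  assumes "0 \<le> s" "s \<le> 1"
  shows "KT s 1 = JT (s + \<tau>)"
proof -
  have "(LINT r|lborel. indicator {0..1 - 1} r * FT (s + r) (1 + r)) = 0"
    by (rule integral_eq_zero_AE, rule eventually_mono[OF AE_lborel_singleton[of 0]]) auto
  then show ?thesis using KT_characteristic[of s 1] assms by simp
qed

text \<open>Both points lie on one characteristic and share the same value of \<open>JT\<close>, so
  subtracting two instances of \<open>KT_characteristic\<close> leaves the integral over the segment
  between them.\<close>

lemma KT_along_characteristic:
  assumes "0 \<le> s" "s \<le> q" "0 \<le> \<rho>" "q + \<rho> \<le> 1"
  shows "KT (s + \<rho>) (q + \<rho>) = KT s q + (LINT r|lborel. indicator {0..\<rho>} r * FT (s + r) (q + r))"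
proof -
  have int: "integrable lborel (\<lambda>r. indicator {a..b} r * FT (s + r) (q + r))" for a b
    by (rule integrable_bounded_interval[where C = \<mu>])
       (use FT_le in \<open>auto simp: abs_mult split: split_indicator\<close>)
  have "(LINT r|lborel. indicator {0..1 - (q + \<rho>)} r * FT (s + \<rho> + r) (q + \<rho> + r))
      = (LINT r|lborel. indicator {0..1 - (q + \<rho>)} (- \<rho> + r) * FT (s + \<rho> + (- \<rho> + r)) (q + \<rho> + (- \<rho> + r)))"
    by (rule integral_shift[symmetric])
  also have "\<dots> = (LINT r|lborel. indicator {\<rho>..1 - q} r * FT (s + r) (q + r))"
    by (intro Bochner_Integration.integral_cong) (auto split: split_indicator)
  finally have 1: "(LINT r|lborel. indicator {0..1 - (q + \<rho>)} r * FT (s + \<rho> + r) (q + \<rho> + r)) = \<dots>" .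
  note 2 = integral_interval_combine[OF int, of 0 \<rho> "1 - q"]
  show ?thesis
    using KT_characteristic[of s q] KT_characteristic[of "s + \<rho>" "q + \<rho>"] assms 1 2 by simp
qed

lemma \<tau>_pos: "0 < \<tau>" using h_pos h_less by simp

text \<open>Transit time: 1 through the plant and \<open>\<tau>\<close> through the two delays. A
  window of \<open>b\<close> of this length encodes the whole state.\<close>

definition N :: real where "N = 1 + \<tau>"
text \<open>Bounds the L1 norm of x by that of \<open>b\<close> over a window:
  \<open>2 * exp (2 * \<kappa>)\<close> inverts the Volterra part and \<open>1 + \<mu>\<close>
  bounds its right-hand side. It is fixed before any solution, as the threshold on
  \<open>\<epsilon>\<close> is built from it.\<close>

definition Cx :: real where "Cx = 2 * exp (2 * \<kappa>) * (1 + \<mu>)"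

lemma N_pos: "0 < N" using \<tau>_pos by (simp add: N_def)
lemma Cx_pos: "0 < Cx" using \<mu>_pos by (simp add: Cx_def)

end

section \<open>Mild solutions along characteristics\<close>

locale solution = plant +
  fixes Kh :: "real \<Rightarrow> real \<Rightarrow> real" and Lh Jh x0 v0 u0 :: "real \<Rightarrow> real"
    and x v u :: "real \<Rightarrow> real \<Rightarrow> real"
  assumes sol: "closed_loop_solution h \<tau> f c Kh Lh Jh x0 v0 u0 x v u"
begin

section \<open>Boundary trace, extended state and source term\<close>

definition \<eta> :: real where "\<eta> = \<tau> - h"
definition b :: "real \<Rightarrow> real" where "b w = indicator {0..} w * u 0 w"
definition xT :: "real \<Rightarrow> real \<Rightarrow> real" where "xT q t = indicator {0..1} q * indicator {0..} t * x q t"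
definition x_L1 :: "real \<Rightarrow> real" where "x_L1 t = (LINT q|lborel. \<bar>xT q t\<bar>)"
definition GT :: "real \<Rightarrow> real \<Rightarrow> real"
  where "GT \<sigma> r = cT \<sigma> * b r + (LINT q|lborel. fT \<sigma> q * xT q r)"

lemma \<eta>_pos: "\<eta> > 0" using h_less by (simp add: \<eta>_def)
lemma \<eta>_le_\<tau>: "\<eta> \<le> \<tau>" using h_pos by (simp add: \<eta>_def)
lemma \<eta>_plus_h: "\<eta> + h = \<tau>" by (simp add: \<eta>_def)

lemma regular: "state_regular x" "state_regular v" "state_regular u"
  and boundary_square_integrable: "T \<ge> 0 \<Longrightarrow> set_integrable lborel {0..T} (\<lambda>r. (u 0 r)\<^sup>2)"
  using sol unfolding closed_loop_solution_def Let_def by blast+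

lemma v_sol: "0 \<le> s \<Longrightarrow> s \<le> 1 \<Longrightarrow> 0 \<le> t \<Longrightarrow>
    v s t = (if s + t / h \<le> 1 then v0 (s + t / h) else x 1 (t - h * (1 - s)))"
  and u_sol: "0 \<le> s \<Longrightarrow> s \<le> 1 \<Longrightarrow> 0 \<le> t \<Longrightarrow>
    u s t = (if s + t / \<eta> \<le> 1 then u0 (s + t / \<eta>) else v 0 (t - \<eta> * (1 - s)))"
  using sol unfolding closed_loop_solution_def Let_def \<eta>_def by auto

lemma x_sol: "0 \<le> s \<Longrightarrow> s \<le> 1 \<Longrightarrow> 0 \<le> t \<Longrightarrow>
    x s t = (if t \<le> s
      then x0 (s - t) + (LBINT r:{0..t}. c (s - t + r) * u 0 r + (LBINT q:{s - t + r..1}. f (s - t + r) q * x q r))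
      else feedback_U h \<tau> Kh Lh Jh x v u (t - s)
        + (LBINT r:{t - s..t}. c (s - t + r) * u 0 r + (LBINT q:{s - t + r..1}. f (s - t + r) q * x q r)))"
  using sol unfolding closed_loop_solution_def Let_def by auto

text \<open>A value in the delay line reaches the outlet unchanged after time
  \<open>\<eta> * s\<close>, whether it stems from \<open>u0\<close> or from v. Hence the trace also
  carries the initial data.\<close>

lemma u_eq_b:
  assumes "0 \<le> s" "s \<le> 1" "0 \<le> t"
  shows "u s t = b (t + \<eta> * s)"
proof -
  have "0 \<le> t + \<eta> * s" using assms \<eta>_pos by simp
  moreover have "(t + \<eta> * s) / \<eta> = s + t / \<eta>" using \<eta>_pos by (simp add: field_simps)
  moreover have "t + \<eta> * s - \<eta> * (1 - 0) = t - \<eta> * (1 - s)" by (simp add: right_diff_distrib)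
  ultimately show ?thesis using assms u_sol[of s t] u_sol[of 0 "t + \<eta> * s"]
    by (simp only: b_def) simp
qed

text \<open>The corner \<open>s = t = 0\<close> is excluded: there v equals \<open>v0 0\<close>,
  while \<open>b \<eta>\<close> equals \<open>u0 1\<close>, and the two need not match.\<close>

lemma v_eq_b:
  assumes "0 \<le> s" "s \<le> 1" "0 \<le> t" "s \<noteq> 0 \<or> t \<noteq> 0"
  shows "v s t = b (t + \<eta> + h * s)"
proof -
  have pos: "0 < t + h * s" using assms h_pos by (auto simp: add_pos_nonneg add_nonneg_pos)
  then have "1 < (t + \<eta> + h * s) / \<eta>" using \<eta>_pos by (simp add: field_simps)
  moreover have "t + \<eta> + h * s - \<eta> = t + h * s" by simp
  ultimately have "b (t + \<eta> + h * s) = v 0 (t + h * s)"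
    using u_sol[of 0 "t + \<eta> + h * s"] pos \<eta>_pos by (auto simp: b_def)
  moreover have "(t + h * s) / h = s + t / h" using h_pos by (simp add: field_simps)
  moreover have "t + h * s - h * (1 - 0) = t - h * (1 - s)" by (simp add: right_diff_distrib)
  ultimately show ?thesis using v_sol[of s t] v_sol[of 0 "t + h * s"] assms pos
    by (simp only:) simp
qed

text \<open>At time 0 the left side is \<open>x0 1\<close> and the right side is
  \<open>v0 1\<close>; agreement starts with the first inflow into the delay.\<close>

lemma x_1_eq_b:
  assumes "0 < t"
  shows "x 1 t = b (t + \<tau>)"
proof -
  have "0 < t / h" using assms h_pos by simp
  then have "\<not> 1 + t / h \<le> 1" by linarith
  then have "v 1 t = x 1 t" using v_sol[of 1 t] assms by simp
  moreover have "t + \<tau> = t + \<eta> + h * 1" by (simp add: \<eta>_def)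
  ultimately show ?thesis using v_eq_b[of 1 t] assms by (simp only:) simp
qed

text \<open>Square integrability of the trace does not control its sign, hence not its
  measurability. That comes from spatial slices: on the n-th interval of length
  \<open>\<eta>\<close> the trace is the rescaled slice of u at time n times \<open>\<eta>\<close>,
  and countably many slices are glued by a floor.\<close>

lemma b_measurable[measurable]: "b \<in> borel_measurable borel"
proof -
  define g where "g = (\<lambda>n w. if n < 0 then 0 else indicator {0..1} ((w - of_int n * \<eta>) / \<eta>)
      * u ((w - of_int n * \<eta>) / \<eta>) (of_int n * \<eta>))"
  have "g n \<in> borel_measurable borel" for n :: int
  proof (cases "n < 0")
    case False
    then have "L2_01 (\<lambda>s. u s (of_int n * \<eta>))"
      using regular(3) \<eta>_pos by (simp add: state_regular_def)
    then have m: "(\<lambda>s. indicator {0..1} s * u s (of_int n * \<eta>)) \<in> borel_measurable borel"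
      by (simp add: L2_01_def set_borel_measurable_def)
    have "(\<lambda>w. (w - of_int n * \<eta>) / \<eta>) \<in> borel_measurable borel" by measurable
    from measurable_compose[OF this m] show ?thesis using False by (simp add: g_def)
  qed (simp add: g_def)
  then have "(\<lambda>w. g \<lfloor>w / \<eta>\<rfloor> w) \<in> borel_measurable borel"
    by (rule measurable_compose_countable[where f = g and g = "\<lambda>w. \<lfloor>w / \<eta>\<rfloor>"]) measurable
  also have "(\<lambda>w. g \<lfloor>w / \<eta>\<rfloor> w) = b"
  proof
    fix w
    let ?n = "\<lfloor>w / \<eta>\<rfloor>"
    have 1: "of_int ?n * \<eta> \<le> w" "w < (of_int ?n + 1) * \<eta>"
      using \<eta>_pos by (simp_all add: pos_le_divide_eq[symmetric] pos_divide_less_eq[symmetric])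
    then have "0 \<le> (w - of_int ?n * \<eta>) / \<eta>" "(w - of_int ?n * \<eta>) / \<eta> \<le> 1"
      using \<eta>_pos by (simp_all add: field_simps)
    moreover have "?n < 0 \<longleftrightarrow> w < 0" using \<eta>_pos by (simp add: floor_less_iff divide_less_0_iff)
    ultimately show "g ?n w = b w"
      using \<eta>_pos u_eq_b[of "(w - of_int ?n * \<eta>) / \<eta>" "of_int ?n * \<eta>"]
      by (cases "w < 0") (simp_all add: g_def b_def)
  qed
  finally show ?thesis .
qed

text \<open>Regularity is given on rectangles of finite height; the ceiling of the time selects one
  that contains the point.\<close>

lemma xT_measurable_pair: "(\<lambda>p. xT (fst p) (snd p)) \<in> borel_measurable (borel \<Otimes>\<^sub>M borel)"
proof -
  define g where "g = (\<lambda>n p. indicator {0..} (snd p)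
     * (indicator ({0..1} \<times> {0..max 0 (of_int n)}) p * x (fst p) (snd p)))"
  have "g n \<in> borel_measurable (borel \<Otimes>\<^sub>M borel)" for n :: int
  proof -
    have "set_borel_measurable lborel ({0..1} \<times> {0..max 0 (of_int n)}) (\<lambda>p. x (fst p) (snd p))"
      using regular(1) by (simp add: state_regular_def)
    then have [measurable]: "(\<lambda>p. indicator ({0..1} \<times> {0..max 0 (of_int n)}) p * x (fst p) (snd p))
        \<in> borel_measurable (borel \<Otimes>\<^sub>M borel)"
      by (simp add: set_borel_measurable_def borel_prod)
    show ?thesis unfolding g_def by measurable
  qed
  then have "(\<lambda>p. g \<lceil>snd p\<rceil> p) \<in> borel_measurable (borel \<Otimes>\<^sub>M borel)"
    by (rule measurable_compose_countable[where f = g and g = "\<lambda>p. \<lceil>snd p\<rceil>"]) measurable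
  also have "(\<lambda>p. g \<lceil>snd p\<rceil> p) = (\<lambda>p. xT (fst p) (snd p))"
  proof
    fix p :: "real \<times> real"
    have "0 \<le> snd p \<Longrightarrow> snd p \<le> max 0 (of_int \<lceil>snd p\<rceil>)" by linarith
    then show "g \<lceil>snd p\<rceil> p = xT (fst p) (snd p)"
      by (cases p) (auto simp: g_def xT_def split: split_indicator)
  qed
  finally show ?thesis .
qed

lemmas xT_measurable[measurable (raw)] = measurable_apply2[where g = xT, OF xT_measurable_pair]

lemma x_L1_measurable[measurable]: "x_L1 \<in> borel_measurable borel"
  unfolding x_L1_def by measurable

lemma GT_measurable_pair: "(\<lambda>p. GT (fst p) (snd p)) \<in> borel_measurable (borel \<Otimes>\<^sub>M borel)"
  unfolding GT_def by measurable

lemmas GT_measurable[measurable (raw)] = measurable_apply2[where g = GT, OF GT_measurable_pair]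

lemma b_square_integrable: "integrable lborel (\<lambda>w. indicator {a..d} w * (b w)\<^sup>2)"
proof -
  have "integrable lborel (\<lambda>w. indicator {0..max 0 d} w * (u 0 w)\<^sup>2)"
    using boundary_square_integrable[of "max 0 d"] by (simp add: set_integrable_def)
  then show ?thesis
    by (rule Bochner_Integration.integrable_bound, measurable)
       (auto simp: b_def split: split_indicator intro!: AE_I2)
qed

lemma b_integrable: "integrable lborel (\<lambda>w. indicator {a..d} w * b w)"
proof -
  have "integrable lborel (\<lambda>w. indicator {a..d} w + indicator {a..d} w * (b w)\<^sup>2)"
    using b_square_integrable
    by (intro Bochner_Integration.integrable_add integrable_indicator_Icc)
  then show ?thesis
    by (rule Bochner_Integration.integrable_bound)
       (use abs_le_one_plus_square in \<open>auto split: split_indicator\<close>)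
qed

lemma xT_square_integrable: "integrable lborel (\<lambda>q. (xT q t)\<^sup>2)"
proof (cases "0 \<le> t")
  case True
  then have "L2_01 (\<lambda>s. x s t)" using regular(1) by (simp add: state_regular_def)
  then have "integrable lborel (\<lambda>s. indicator {0..1} s * (x s t)\<^sup>2)"
    by (simp add: L2_01_def set_integrable_def)
  also have "(\<lambda>s. indicator {0..1} s * (x s t)\<^sup>2) = (\<lambda>q. (xT q t)\<^sup>2)"
    using True by (auto simp: fun_eq_iff xT_def split: split_indicator)
  finally show ?thesis .
qed (simp add: xT_def)

lemma abs_xT_le: "\<bar>xT q t\<bar> \<le> indicator {0..1} q + (xT q t)\<^sup>2"
  using abs_le_one_plus_square[of "xT q t"] by (auto simp: xT_def split: split_indicator)

lemma xT_integrable: "integrable lborel (\<lambda>q. xT q t)"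
proof -
  have "integrable lborel (\<lambda>q. indicator {0..1} q + (xT q t)\<^sup>2)"
    using xT_square_integrable
    by (intro Bochner_Integration.integrable_add integrable_indicator_Icc)
  then show ?thesis
    by (rule Bochner_Integration.integrable_bound)
       (use abs_xT_le in \<open>auto intro!: AE_I2 order.trans[OF _ abs_ge_self]\<close>)
qed

lemma x_L1_nonneg: "0 \<le> x_L1 t" by (simp add: x_L1_def)

text \<open>On a rectangle \<open>\<bar>x\<bar> \<le> 1 + x\<^sup>2\<close> is integrable; Fubini
  then leaves the spatial L1 norm as a function of time.\<close>

lemma x_L1_integrable: "integrable lborel (\<lambda>r. indicator {a..d} r * x_L1 r)"
proof -
  let ?R = "{0..1} \<times> {0..max 0 d}"
  have "set_integrable lborel ?R (\<lambda>p. (x (fst p) (snd p))\<^sup>2)"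
    using regular(1) by (simp add: state_regular_def)
  then have "integrable lborel (\<lambda>p. indicator ?R p + indicator ?R p * (x (fst p) (snd p))\<^sup>2)"
    by (intro Bochner_Integration.integrable_add integrable_real_indicator)
       (auto simp: set_integrable_def lborel_prod[symmetric] lborel.emeasure_pair_measure_Times emeasure_lborel_Icc_eq ennreal_mult_less_top)
  then have "integrable (lborel \<Otimes>\<^sub>M lborel) (\<lambda>p. indicator {a..d} (snd p) * \<bar>xT (fst p) (snd p)\<bar>)"
    unfolding lborel_prod[symmetric]
    by (rule Bochner_Integration.integrable_bound, measurable)
       (use abs_le_one_plus_square in \<open>auto simp: xT_def split: split_indicator intro!: AE_I2\<close>)
  from lborel_pair.integrable_product_swap[OF this]
  have "integrable (lborel \<Otimes>\<^sub>M lborel) (\<lambda>(r, q). indicator {a..d} r * \<bar>xT q r\<bar>)" by simp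
  from lborel_pair.integrable_fst'[OF this] show ?thesis by (simp add: x_L1_def)
qed

text \<open>Majorant of \<open>GT\<close>, up to the factor \<open>\<kappa>\<close>, that depends on
  time only; it controls integrals along all characteristics at once.\<close>

definition source_bound :: "real \<Rightarrow> real" where "source_bound r = \<bar>b r\<bar> + x_L1 r"

lemma source_bound_nonneg: "0 \<le> source_bound r" using x_L1_nonneg by (simp add: source_bound_def)

lemma source_bound_measurable[measurable]: "source_bound \<in> borel_measurable borel"
  unfolding source_bound_def by measurable

lemma source_bound_integrable: "integrable lborel (\<lambda>r. indicator {a..d} r * source_bound r)"
proof -
  have "integrable lborel (\<lambda>r. \<bar>indicator {a..d} r * b r\<bar> + indicator {a..d} r * x_L1 r)"
    by (intro Bochner_Integration.integrable_add integrable_abs b_integrable x_L1_integrable)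
  then show ?thesis by (simp add: source_bound_def abs_mult distrib_left)
qed

lemma fT_xT_integrable: "integrable lborel (\<lambda>q. fT \<sigma> q * xT q r)"
  by (rule Bochner_Integration.integrable_bound[OF integrable_mult_right[OF xT_integrable[of r], of \<kappa>]])
     (use \<kappa>_bounds in \<open>auto simp: abs_mult intro!: mult_right_mono\<close>)

lemma GT_le: "\<bar>GT \<sigma> r\<bar> \<le> \<kappa> * source_bound r * indicator {0..1} \<sigma>"
proof (cases "\<sigma> \<in> {0..1}")
  case True
  have "\<bar>LINT q|lborel. fT \<sigma> q * xT q r\<bar> \<le> (LINT q|lborel. \<bar>fT \<sigma> q * xT q r\<bar>)"
    by (rule integral_abs_bound)
  also have "\<dots> \<le> (LINT q|lborel. \<kappa> * \<bar>xT q r\<bar>)"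
    by (rule integral_mono[OF integrable_abs[OF fT_xT_integrable]])
       (use xT_integrable \<kappa>_bounds in \<open>auto simp: abs_mult intro!: mult_right_mono\<close>)
  also have "\<dots> = \<kappa> * x_L1 r" by (simp add: x_L1_def)
  finally have "\<bar>LINT q|lborel. fT \<sigma> q * xT q r\<bar> \<le> \<kappa> * x_L1 r" .
  moreover have "\<bar>cT \<sigma> * b r\<bar> \<le> \<kappa> * \<bar>b r\<bar>"
    using \<kappa>_bounds by (simp add: abs_mult mult_right_mono)
  ultimately show ?thesis using True by (simp add: GT_def source_bound_def distrib_left)
next
  case False
  then have "fT \<sigma> q = 0" for q by (auto simp: fT_def T1_def)
  then show ?thesis using False by (simp add: GT_def cT_def)
qed

lemma GT_eq:
  assumes "0 \<le> \<sigma>" "\<sigma> \<le> 1" "0 \<le> r"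
  shows "GT \<sigma> r = c \<sigma> * u 0 r + (LBINT q:{\<sigma>..1}. f \<sigma> q * x q r)"
proof -
  have "(LBINT q:{\<sigma>..1}. f \<sigma> q * x q r) = (LINT q|lborel. fT \<sigma> q * xT q r)"
    unfolding set_lebesgue_integral_def
    by (rule Bochner_Integration.integral_cong)
       (use assms in \<open>auto simp: fT_def xT_def T1_def split: split_indicator\<close>)
  then show ?thesis using assms by (simp add: GT_def cT_def b_def)
qed

lemma GT_along_integrable: "integrable lborel (\<lambda>w. indicator {a..d} w * GT (s + w) (t + w))"
proof (rule Bochner_Integration.integrable_bound)
  have "integrable lborel (\<lambda>w. indicator {t + a..t + d} (t + w) * source_bound (t + w))"
    using source_bound_integrable by (simp only: integrable_shift[where g = "\<lambda>w. indicator {t + a..t + d} w * source_bound w"])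
  then show "integrable lborel (\<lambda>w. \<kappa> * (indicator {t + a..t + d} (t + w) * source_bound (t + w)))"
    by (rule integrable_mult_right)
  have "\<bar>GT (s + w) (t + w)\<bar> \<le> \<kappa> * source_bound (t + w)" for w
    using GT_le[of "s + w" "t + w"] \<kappa>_bounds(1) source_bound_nonneg[of "t + w"] by (auto split: split_indicator_asm)
  then show "AE w in lborel. norm (indicator {a..d} w * GT (s + w) (t + w))
      \<le> norm (\<kappa> * (indicator {t + a..t + d} (t + w) * source_bound (t + w)))"
    by (auto split: split_indicator intro!: AE_I2 order.trans[OF _ abs_ge_self])
qed measurable

text \<open>Both points fall into the same branch of the mild formula and have the same foot, so
  subtraction leaves the integral between them.\<close>

lemma x_along_characteristic:
  assumes "0 \<le> s" "0 \<le> t" "0 \<le> r" "s + r \<le> 1"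
  shows "x (s + r) (t + r) = x s t + (LINT w|lborel. indicator {0..r} w * GT (s + w) (t + w))"
proof -
  \<comment> \<open>\<open>a\<close> and \<open>y\<close> are the time and the value at the foot of
    the characteristic: at time 0 if \<open>t \<le> s\<close>, otherwise at the inlet.\<close>
  define a where "a = max 0 (t - s)"
  define y where "y = (if t \<le> s then x0 (s - t) else feedback_U h \<tau> Kh Lh Jh x v u (t - s))"
  let ?I = "\<lambda>\<alpha> \<beta>. LINT w|lborel. indicator {\<alpha>..\<beta>} w * GT (s - t + w) w"
  have int: "integrable lborel (\<lambda>w. indicator {\<alpha>..\<beta>} w * GT (s - t + w) w)" for \<alpha> \<beta>
    using GT_along_integrable[of \<alpha> \<beta> "s - t" 0] by simp
  have *: "x (s + r') (t + r') = y + ?I a (t + r')" if "0 \<le> r'" "s + r' \<le> 1" for r'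
  proof -
    have "(LBINT w:{a..t + r'}. c (s - t + w) * u 0 w + (LBINT q:{s - t + w..1}. f (s - t + w) q * x q w))
        = ?I a (t + r')"
      unfolding set_lebesgue_integral_def[of _ "{a..t + r'}"]
      by (rule Bochner_Integration.integral_cong)
         (use that assms in \<open>auto simp: a_def GT_eq split: split_indicator\<close>)
    then show ?thesis
      using x_sol[of "s + r'" "t + r'"] that assms by (auto simp: y_def a_def add.commute)
  qed
  have "?I a (t + r) = ?I a t + ?I t (t + r)"
    using assms by (intro integral_interval_combine[symmetric] int) (auto simp: a_def)
  also have "?I t (t + r) = (LINT w|lborel. indicator {t..t + r} (t + w) * GT (s - t + (t + w)) (t + w))"
    by (rule integral_shift[symmetric])
  also have "\<dots> = (LINT w|lborel. indicator {0..r} w * GT (s + w) (t + w))"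
    by (rule Bochner_Integration.integral_cong) (auto split: split_indicator)
  finally show ?thesis using *[of 0] *[of r] assms by simp
qed

section \<open>The backstepping transform\<close>

lemma FT_xT_le: "\<bar>FT s q * xT q t\<bar> \<le> \<mu> * \<bar>xT q t\<bar>"
  using FT_le by (simp add: abs_mult mult_right_mono)

lemma KT_xT_integrable: "integrable lborel (\<lambda>q. KT s q * xT q t)"
  by (rule Bochner_Integration.integrable_bound[OF integrable_mult_right[OF xT_integrable[of t], of \<kappa>]])
     (use \<kappa>_bounds in \<open>auto simp: abs_mult intro!: mult_right_mono\<close>)

lemma KT_GT_le: "\<bar>KT s q * GT q' t\<bar> \<le> \<kappa> * \<kappa> * source_bound t * indicator {0..1} q'"
proof -
  have "\<bar>KT s q\<bar> * \<bar>GT q' t\<bar> \<le> \<kappa> * (\<kappa> * source_bound t * indicator {0..1} q')"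
    using \<kappa>_bounds source_bound_nonneg by (intro mult_mono GT_le) auto
  then show ?thesis by (simp add: abs_mult mult_ac)
qed

text \<open>The double integral of K f x occurs with a minus sign through \<open>FT\<close> and with
  a plus sign through \<open>GT\<close>, and Fubini identifies the two copies. What is left is the
  integral of f x plus \<open>b t\<close> times that of K c, and the latter is
  \<open>JT s + cT s\<close>.\<close>

lemma kernel_cancellation:
  "(LINT q|lborel. FT s q * xT q t + KT s q * GT q t) = GT s t + b t * JT s"
proof -
  let ?H = "\<lambda>q r. KT s q * fT q r * xT r t"
  have pair_int: "integrable (lborel \<Otimes>\<^sub>M lborel) (\<lambda>(q, r). ?H q r)"
  proof (rule Bochner_Integration.integrable_bound)
    show "integrable (lborel \<Otimes>\<^sub>M lborel) (\<lambda>(q, r). (\<kappa> * \<kappa> * indicator {0..1} (q::real)) * xT r t)"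
    proof (rule lborel_pair.Fubini_integrable)
      show "integrable lborel (\<lambda>q. LINT r|lborel. norm (case (q, r) of (q, r) \<Rightarrow> (\<kappa> * \<kappa> * indicator {0..1} (q::real)) * xT r t))"
        using \<kappa>_bounds(1) by (simp add: abs_mult integrable_indicator_Icc)
      show "AE q in lborel. integrable lborel (\<lambda>r. case (q, r) of (q, r) \<Rightarrow> (\<kappa> * \<kappa> * indicator {0..1} (q::real)) * xT r t)"
        using xT_integrable by (intro AE_I2) simp
    qed measurable
    have "\<bar>?H q r\<bar> \<le> \<bar>(\<kappa> * \<kappa> * indicator {0..1} (q::real)) * xT r t\<bar>" for q r
      using mult_right_mono[OF KT_fT_le[of s q q r] abs_ge_zero[of "xT r t"]] by (simp add: abs_mult)
    then show "AE p in lborel \<Otimes>\<^sub>M lborel. norm (case p of (q, r) \<Rightarrow> ?H q r)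
        \<le> norm (case p of (q, r) \<Rightarrow> (\<kappa> * \<kappa> * indicator {0..1} (q::real)) * xT r t)"
      by (intro AE_I2) (auto split: prod.split)
  qed measurable
  have swap: "(LINT q|lborel. LINT r|lborel. ?H q r) = (LINT r|lborel. LINT q|lborel. ?H q r)"
    using lborel_pair.Fubini_integral[OF pair_int] by simp
  have row: "(LINT r|lborel. ?H q r) = KT s q * (LINT r|lborel. fT q r * xT r t)" for q
    by (simp only: mult.assoc integral_mult_right_zero)
  have col: "(LINT q|lborel. ?H q r) = (LINT q|lborel. KT s q * fT q r) * xT r t" for r
    by (simp only: integral_mult_left_zero)
  have colint: "integrable lborel (\<lambda>r. (LINT q|lborel. KT s q * fT q r) * xT r t)"
    using lborel_pair.integrable_fst'[OF lborel_pair.integrable_product_swap[OF pair_int]] by (simp add: col)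
  have rowint: "integrable lborel (\<lambda>q. KT s q * (LINT r|lborel. fT q r * xT r t))"
    using lborel_pair.integrable_fst'[OF pair_int] by (simp add: row)
  have kc: "integrable lborel (\<lambda>q. KT s q * cT q)"
    by (rule integrable_bounded_interval[where C = "\<kappa> * \<kappa>" and a = 0 and b = 1]) (use KT_cT_le in auto)
  have "(LINT q|lborel. FT s q * xT q t + KT s q * GT q t)
      = (LINT q|lborel. (fT s q * xT q t - (LINT r|lborel. KT s r * fT r q) * xT q t)
           + (b t * (KT s q * cT q) + KT s q * (LINT r|lborel. fT q r * xT r t)))"
    by (simp add: FT_def GT_def algebra_simps)
  also have "\<dots> = (LINT q|lborel. fT s q * xT q t) - (LINT q|lborel. (LINT r|lborel. KT s r * fT r q) * xT q t)
      + (b t * (LINT q|lborel. KT s q * cT q) + (LINT q|lborel. KT s q * (LINT r|lborel. fT q r * xT r t)))"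
    using fT_xT_integrable colint rowint kc by simp
  also have "\<dots> = GT s t + b t * JT s"
    using swap unfolding row col by (simp add: GT_def JT_def algebra_simps)
  finally show ?thesis .
qed

text \<open>The formal derivative in \<open>r\<close> of K(s + r, q + r) x(q + r, t + r). Computing
  its double integral in both orders yields the evolution of \<open>kernel_part\<close>.\<close>

definition char_density :: "real \<Rightarrow> real \<Rightarrow> real \<Rightarrow> real \<Rightarrow> real" where
  "char_density s t r q = FT (s + r) (q + r) * xT (q + r) (t + r) + KT (s + r) (q + r) * GT (q + r) (t + r)"

lemma char_density_integrable: "integrable (lborel \<Otimes>\<^sub>M lborel) (\<lambda>(r, q). indicator {0..\<rho>} r * char_density s t r q)"
proof (rule Bochner_Integration.integrable_bound)
  let ?D = "\<lambda>r q. indicator {0..\<rho>} r * (\<mu> * \<bar>xT (r + q) (t + r)\<bar> + \<kappa> * \<kappa> * source_bound (t + r) * indicator {0..1} (r + q))"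
  have D_nonneg: "0 \<le> ?D r q" for r q
    using \<mu>_pos source_bound_nonneg[of "t + r"] \<kappa>_bounds(1) by simp
  have shifted: "integrable lborel (\<lambda>q. \<bar>xT (r + q) t'\<bar>)" "integrable lborel (\<lambda>q. indicator {0..1} (r + q) :: real)" for r t'
    using integrable_shift[of "\<lambda>q. \<bar>xT q t'\<bar>" r] integrable_shift[of "indicator {0..1}" r] xT_integrable
    by (auto simp: integrable_indicator_Icc)
  have row: "(LINT q|lborel. ?D r q) = indicator {0..\<rho>} r * (\<mu> * x_L1 (t + r) + \<kappa> * \<kappa> * source_bound (t + r))" for r
    using shifted integral_shift[of "\<lambda>q. \<bar>xT q (t + r)\<bar>" r] integral_shift[of "indicator {0..1}" r]
    by (simp add: x_L1_def)
  show "integrable (lborel \<Otimes>\<^sub>M lborel) (\<lambda>(r, q). ?D r q)"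
  proof (rule lborel_pair.Fubini_integrable)
    have "integrable lborel (\<lambda>r. \<mu> * (indicator {t..t + \<rho>} (t + r) * x_L1 (t + r))
        + \<kappa> * \<kappa> * (indicator {t..t + \<rho>} (t + r) * source_bound (t + r)))"
      by (intro Bochner_Integration.integrable_add integrable_mult_right)
         (simp_all only: integrable_shift[where g = "\<lambda>r. indicator {t..t + \<rho>} r * x_L1 r"]
            integrable_shift[where g = "\<lambda>r. indicator {t..t + \<rho>} r * source_bound r"] x_L1_integrable source_bound_integrable)
    also have "(\<lambda>r. \<mu> * (indicator {t..t + \<rho>} (t + r) * x_L1 (t + r))
        + \<kappa> * \<kappa> * (indicator {t..t + \<rho>} (t + r) * source_bound (t + r)))
      = (\<lambda>r. indicator {0..\<rho>} r * (\<mu> * x_L1 (t + r) + \<kappa> * \<kappa> * source_bound (t + r)))"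
      by (auto simp: fun_eq_iff algebra_simps split: split_indicator)
    finally show "integrable lborel (\<lambda>r. LINT q|lborel. norm (case (r, q) of (r, q) \<Rightarrow> ?D r q))"
      by (simp only: prod.case real_norm_def abs_of_nonneg[OF D_nonneg] row)
    show "AE r in lborel. integrable lborel (\<lambda>q. case (r, q) of (r, q) \<Rightarrow> ?D r q)"
      using shifted by (intro AE_I2) simp
  qed measurable
  have "\<bar>indicator {0..\<rho>} r * char_density s t r q\<bar> \<le> ?D r q" for r q
    using FT_xT_le[of "s + r" "q + r" "t + r"] KT_GT_le[of "s + r" "q + r" "q + r" "t + r"]
    by (auto simp: char_density_def add.commute split: split_indicator)
  then show "AE p in lborel \<Otimes>\<^sub>M lborel. norm (case p of (r, q) \<Rightarrow> indicator {0..\<rho>} r * char_density s t r q)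
      \<le> norm (case p of (r, q) \<Rightarrow> ?D r q)"
    by (intro AE_I2) (auto split: prod.split intro: order.trans[OF _ abs_ge_self])
  show "(\<lambda>(r, q). indicator {0..\<rho>} r * char_density s t r q) \<in> borel_measurable (lborel \<Otimes>\<^sub>M lborel)"
    unfolding char_density_def by measurable
qed

lemma char_density_integral_q: "(LINT q|lborel. char_density s t r q) = GT (s + r) (t + r) + b (t + r) * JT (s + r)"
proof -
  have "(LINT q|lborel. char_density s t r q) = (LINT q|lborel. (\<lambda>q. FT (s + r) q * xT q (t + r) + KT (s + r) q * GT q (t + r)) (r + q))"
    by (simp add: char_density_def add.commute)
  also have "\<dots> = (LINT q|lborel. FT (s + r) q * xT q (t + r) + KT (s + r) q * GT q (t + r))"
    by (rule integral_shift)
  finally show ?thesis by (simp only: kernel_cancellation)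
qed

text \<open>Product rule on a segment inside the triangle: \<open>FT\<close> is the density of the
  kernel along it and \<open>GT\<close> that of the state.\<close>

lemma char_density_integral_r:
  assumes "0 \<le> s" "0 \<le> t" "s \<le> q" "0 \<le> m" "q + m \<le> 1"
  shows "(LINT r|lborel. indicator {0..m} r * char_density s t r q) = KT (s + m) (q + m) * x (q + m) (t + m) - KT s q * x q t"
proof -
  let ?k = "\<lambda>r. KT (s + r) (q + r)" and ?y = "\<lambda>r. x (q + r) (t + r)"
  have "?k m * ?y m = ?k 0 * ?y 0
     + (LINT r|lborel. indicator {0..m} r * (FT (s + r) (q + r) * ?y r + ?k r * GT (q + r) (t + r)))"
  proof (rule product_rule_absolutely_continuous)
    show "integrable lborel (\<lambda>r. indicator {0..m} r * FT (s + r) (q + r))"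
      by (rule integrable_bounded_interval[where C = \<mu>])
         (use FT_le in \<open>auto simp: abs_mult split: split_indicator\<close>)
    show "integrable lborel (\<lambda>r. indicator {0..m} r * GT (q + r) (t + r))"
      by (rule GT_along_integrable)
  qed (use assms KT_along_characteristic x_along_characteristic in auto)
  also have "(LINT r|lborel. indicator {0..m} r * (FT (s + r) (q + r) * ?y r + ?k r * GT (q + r) (t + r)))
      = (LINT r|lborel. indicator {0..m} r * char_density s t r q)"
    by (rule Bochner_Integration.integral_cong) (use assms in \<open>auto simp: char_density_def xT_def split: split_indicator\<close>)
  finally show ?thesis by simp
qed

section \<open>The transform and its transport\<close>

definition kernel_part :: "real \<Rightarrow> real \<Rightarrow> real" where "kernel_part s t = (LINT q|lborel. KT s q * xT q t)"
definition delay_part :: "real \<Rightarrow> real \<Rightarrow> real"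
  where "delay_part s t = (LINT \<sigma>|lborel. indicator {0..\<tau>} \<sigma> * (JT (s + \<sigma>) * b (t + \<sigma>)))"

lemma JT_b_integrable: "integrable lborel (\<lambda>\<sigma>. indicator {a..d} \<sigma> * (JT (s + \<sigma>) * b (t + \<sigma>)))"
proof (rule Bochner_Integration.integrable_bound)
  show "integrable lborel (\<lambda>\<sigma>. \<mu> * (indicator {t + a..t + d} (t + \<sigma>) * b (t + \<sigma>)))"
    by (rule integrable_mult_right)
       (simp only: integrable_shift[where g = "\<lambda>w. indicator {t + a..t + d} w * b w"] b_integrable)
  show "AE \<sigma> in lborel. norm (indicator {a..d} \<sigma> * (JT (s + \<sigma>) * b (t + \<sigma>)))
      \<le> norm (\<mu> * (indicator {t + a..t + d} (t + \<sigma>) * b (t + \<sigma>)))"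
    using JT_le \<mu>_pos by (intro AE_I2) (auto simp: abs_mult mult_right_mono split: split_indicator)
qed measurable

text \<open>
  The characteristic starting at \<open>q\<close> leaves \<open>[0, 1]\<close> after time \<open>1 - q\<close>; the boundary value
  \<open>K(s, 1) = J(s + \<tau>)\<close> turns this outflow into the last term, which cancels against the inflow of
  the delay part.
\<close>

lemma kernel_part_along_characteristic:
  assumes s: "0 \<le> s" and t: "0 \<le> t" and \<rho>: "0 \<le> \<rho>" and s\<rho>: "s + \<rho> \<le> 1"
  shows "kernel_part (s + \<rho>) (t + \<rho>) - kernel_part s t
    = (LINT r|lborel. indicator {0..\<rho>} r * GT (s + r) (t + r))
      + (LINT r|lborel. indicator {0..\<rho>} r * (JT (s + r) * b (t + r)))
      - (LINT r|lborel. indicator {0..\<rho>} r * (JT (s + \<tau> + r) * b (t + \<tau> + r)))"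
proof -
  let ?E = "\<lambda>r. indicator {0..\<rho>} r * (JT (s + \<tau> + r) * b (t + \<tau> + r))"
  have E: "integrable lborel ?E" by (rule JT_b_integrable)
  have "AE q in lborel. (LINT r|lborel. indicator {0..\<rho>} r * char_density s t r q)
      = KT (s + \<rho>) (\<rho> + q) * xT (\<rho> + q) (t + \<rho>) + ?E (1 - q) - KT s q * xT q t"
    \<comment> \<open>At \<open>q = 1 - \<rho>\<close> the exit value would be counted twice, and at
      \<open>q = 1\<close> the initial value of x may differ from \<open>b\<close>. Both are single
      points.\<close>
    using AE_lborel_singleton[of 1] AE_lborel_singleton[of "1 - \<rho>"]
  proof eventually_elim
    case (elim q)
    have zero: "(LINT r|lborel. indicator {0..\<rho>} r * char_density s t r q) = 0" if "q < s \<or> 1 < q"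
    proof -
      have *: "indicator {0..\<rho>} r * char_density s t r q = 0" for r
        using that by (auto simp: char_density_def FT_outside KT_outside T1_def split: split_indicator)
      show ?thesis unfolding * by simp
    qed
    \<comment> \<open>The starting point is below the diagonal, beyond 1, inside for the whole time,
      or leaves at \<open>r = 1 - q\<close>. Only in the last case is \<open>?E (1 - q)\<close>
      switched on, and there \<open>KT (s + \<rho>) (q + \<rho>)\<close> is zero.\<close>
    consider "q < s" | "1 < q" | "s \<le> q" "q + \<rho> \<le> 1" | "s \<le> q" "q < 1" "1 < q + \<rho>"
      using elim by linarith
    then show ?case
    proof cases
      case 1
      then show ?thesis using zero s\<rho> by (simp add: KT_outside T1_def)
    next
      case 2
      then show ?thesis using zero \<rho> by (simp add: KT_outside T1_def)
    next
      case 3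
      then have "1 - q > \<rho>" using elim by auto
      then show ?thesis
        using char_density_integral_r[of s t q \<rho>] 3 assms by (simp add: xT_def add.commute)
    next
      case 4
      have "(LINT r|lborel. indicator {0..\<rho>} r * char_density s t r q) = (LINT r|lborel. indicator {0..1 - q} r * char_density s t r q)"
        by (rule Bochner_Integration.integral_cong)
           (use 4 in \<open>auto simp: char_density_def FT_outside KT_outside T1_def split: split_indicator\<close>)
      also have "\<dots> = KT (s + (1 - q)) 1 * x 1 (t + (1 - q)) - KT s q * x q t"
        using char_density_integral_r[of s t q "1 - q"] 4 assms by simp
      also have "KT (s + (1 - q)) 1 = JT (s + (1 - q) + \<tau>)"
        using 4 assms by (intro KT_right_boundary) auto
      also have "x 1 (t + (1 - q)) = b (t + (1 - q) + \<tau>)"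
        using 4 assms by (intro x_1_eq_b) auto
      finally show ?thesis
        using 4 assms by (simp add: KT_outside T1_def xT_def algebra_simps)
    qed
  qed
  then have "(LINT q|lborel. LINT r|lborel. indicator {0..\<rho>} r * char_density s t r q)
     = (LINT q|lborel. KT (s + \<rho>) (\<rho> + q) * xT (\<rho> + q) (t + \<rho>) + ?E (1 - q) - KT s q * xT q t)"
    by (intro integral_cong_AE) (simp_all add: char_density_def)
  also have "\<dots> = (LINT q|lborel. KT (s + \<rho>) (\<rho> + q) * xT (\<rho> + q) (t + \<rho>)) + (LINT q|lborel. ?E (1 - q))
      - (LINT q|lborel. KT s q * xT q t)"
  proof -
    have "integrable lborel (\<lambda>q. KT (s + \<rho>) (\<rho> + q) * xT (\<rho> + q) (t + \<rho>))"
      using integrable_shift[of "\<lambda>q. KT (s + \<rho>) q * xT q (t + \<rho>)" \<rho>] KT_xT_integrable by blast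
    moreover have "integrable lborel (\<lambda>q. ?E (1 - q))"
      using integrable_reflect[of ?E 1] E by blast
    ultimately show ?thesis
      by (subst Bochner_Integration.integral_diff, rule Bochner_Integration.integrable_add)
         (auto intro: KT_xT_integrable)
  qed
  also have "(LINT q|lborel. KT (s + \<rho>) (\<rho> + q) * xT (\<rho> + q) (t + \<rho>)) = kernel_part (s + \<rho>) (t + \<rho>)"
    unfolding kernel_part_def by (rule integral_shift[where g = "\<lambda>q. KT (s + \<rho>) q * xT q (t + \<rho>)"])
  also have "(LINT q|lborel. ?E (1 - q)) = (LINT r|lborel. ?E r)"
    by (rule integral_reflect)
  \<comment> \<open>The other order of integration: for fixed \<open>r\<close> the integral over
    \<open>q\<close> is given by the cancellation identity.\<close>
  also have "(LINT q|lborel. LINT r|lborel. indicator {0..\<rho>} r * char_density s t r q)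
      = (LINT r|lborel. LINT q|lborel. indicator {0..\<rho>} r * char_density s t r q)"
    using lborel_pair.Fubini_integral[OF char_density_integrable] by simp
  also have "\<dots> = (LINT r|lborel. indicator {0..\<rho>} r * GT (s + r) (t + r) + indicator {0..\<rho>} r * (JT (s + r) * b (t + r)))"
    by (simp only: integral_mult_right_zero char_density_integral_q) (simp add: algebra_simps)
  also have "\<dots> = (LINT r|lborel. indicator {0..\<rho>} r * GT (s + r) (t + r))
      + (LINT r|lborel. indicator {0..\<rho>} r * (JT (s + r) * b (t + r)))"
    by (rule Bochner_Integration.integral_add[OF GT_along_integrable JT_b_integrable])
  finally show ?thesis by (simp add: kernel_part_def)
qed

text \<open>Shifting both arguments moves the integration window from \<open>[0, \<tau>]\<close> to
  \<open>[\<rho>, \<rho> + \<tau>]\<close>. Comparing both with \<open>[0, \<rho> + \<tau>]\<close>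
  leaves the gain at the far end and the loss at the near end.\<close>

lemma delay_part_along_characteristic:
  assumes "0 \<le> \<rho>"
  shows "delay_part (s + \<rho>) (t + \<rho>) - delay_part s t
    = (LINT r|lborel. indicator {0..\<rho>} r * (JT (s + \<tau> + r) * b (t + \<tau> + r)))
      - (LINT r|lborel. indicator {0..\<rho>} r * (JT (s + r) * b (t + r)))"
proof -
  let ?I = "\<lambda>\<alpha> \<beta>. LINT \<sigma>|lborel. indicator {\<alpha>..\<beta>} \<sigma> * (JT (s + \<sigma>) * b (t + \<sigma>))"
  have shift: "(LINT r|lborel. indicator {0..d} r * (JT (s + e + r) * b (t + e + r))) = ?I e (e + d)" for e d
    by (subst integral_shift[where a = e, symmetric], rule Bochner_Integration.integral_cong)
       (auto simp: add.assoc split: split_indicator)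
  have "?I 0 \<rho> + ?I \<rho> (\<rho> + \<tau>) = ?I 0 (\<rho> + \<tau>)" "?I 0 \<tau> + ?I \<tau> (\<tau> + \<rho>) = ?I 0 (\<tau> + \<rho>)"
    using assms h_pos h_less by (intro integral_interval_combine JT_b_integrable; simp)+
  then show ?thesis using shift[of \<tau> \<rho>] shift[of \<tau> 0] shift[of \<rho> \<tau>] by (simp add: delay_part_def add.commute)
qed

lemma backstepping_transform_transported:
  assumes "0 \<le> s" "0 \<le> t" "0 \<le> \<rho>" "s + \<rho> \<le> 1"
  shows "x (s + \<rho>) (t + \<rho>) - kernel_part (s + \<rho>) (t + \<rho>) - delay_part (s + \<rho>) (t + \<rho>) = x s t - kernel_part s t - delay_part s t"
  using x_along_characteristic[OF assms(1,2,3,4)] kernel_part_along_characteristic[OF assms]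
    delay_part_along_characteristic[OF assms(3), of s t] by simp

text \<open>Follow the characteristic to \<open>s = 1\<close>: there the Volterra part integrates
  over one point and J vanishes, so only x at the outlet remains. For \<open>s = 1\<close> and
  \<open>t = 0\<close> the outlet value is still unrelated to \<open>b\<close>.\<close>

lemma backstepping_transform_eq_b:
  assumes "0 \<le> s" "s \<le> 1" "0 \<le> t" "s \<noteq> 1 \<or> t \<noteq> 0"
  shows "x s t - kernel_part s t - delay_part s t = b (t + (1 + \<tau> - s))"
proof -
  have "kernel_part 1 (t + (1 - s)) = 0"
    unfolding kernel_part_def
    by (rule integral_eq_zero_AE, rule eventually_mono[OF AE_lborel_singleton[of 1]])
       (auto simp: KT_outside T1_def)
  moreover have "JT (1 + \<sigma>) = 0" if "0 \<le> \<sigma>" for \<sigma>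
    using kernel_J_eq_JT[of "1 + \<sigma>"] that by (simp add: kernel_J_def)
  then have "indicator {0..\<tau>} \<sigma> * (JT (1 + \<sigma>) * b (t + (1 - s) + \<sigma>)) = 0" for \<sigma>
    by (auto split: split_indicator)
  then have "delay_part 1 (t + (1 - s)) = 0" by (simp only: delay_part_def integral_zero)
  moreover have "x 1 (t + (1 - s)) = b (t + (1 - s) + \<tau>)"
    using assms by (intro x_1_eq_b) auto
  ultimately show ?thesis
    using backstepping_transform_transported[of s t "1 - s"] assms by (simp add: algebra_simps)
qed

section \<open>Norm equivalence with a window of the boundary trace\<close>

definition window_L1 :: "real \<Rightarrow> real" where "window_L1 t = (LINT \<sigma>|lborel. indicator {0..N} \<sigma> * \<bar>b (t + \<sigma>)\<bar>)"
definition window_energy :: "real \<Rightarrow> real" where "window_energy t = (LINT w|lborel. indicator {t..t + N} w * (b w)\<^sup>2)"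

lemma b_shift_integrable:
  "integrable lborel (\<lambda>\<sigma>. indicator {a..d} \<sigma> * b (t + \<sigma>))"
  "integrable lborel (\<lambda>\<sigma>. indicator {a..d} \<sigma> * \<bar>b (t + \<sigma>)\<bar>)"
  "integrable lborel (\<lambda>\<sigma>. indicator {a..d} \<sigma> * (b (t + \<sigma>))\<^sup>2)"
proof -
  have ind: "indicator {t + a..t + d} (t + \<sigma>) = (indicator {a..d} \<sigma> :: real)" for \<sigma>
    by (auto split: split_indicator)
  show 1: "integrable lborel (\<lambda>\<sigma>. indicator {a..d} \<sigma> * b (t + \<sigma>))"
    using b_integrable[of "t + a" "t + d"] integrable_shift[of "\<lambda>w. indicator {t + a..t + d} w * b w" t]
    by (simp add: ind)
  show "integrable lborel (\<lambda>\<sigma>. indicator {a..d} \<sigma> * (b (t + \<sigma>))\<^sup>2)"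
    using b_square_integrable[of "t + a" "t + d"] integrable_shift[of "\<lambda>w. indicator {t + a..t + d} w * (b w)\<^sup>2" t]
    by (simp add: ind)
  show "integrable lborel (\<lambda>\<sigma>. indicator {a..d} \<sigma> * \<bar>b (t + \<sigma>)\<bar>)"
    using integrable_abs[OF 1] by (simp add: abs_mult)
qed

lemma b_window_mono:
  assumes "0 \<le> a" "d \<le> N"
  shows "(LINT \<sigma>|lborel. indicator {a..d} \<sigma> * \<bar>b (t + \<sigma>)\<bar>) \<le> window_L1 t"
  unfolding window_L1_def
  by (intro integral_mono b_shift_integrable) (use assms in \<open>auto split: split_indicator\<close>)

lemma window_energy_shift: "window_energy t = (LINT \<sigma>|lborel. indicator {0..N} \<sigma> * (b (t + \<sigma>))\<^sup>2)"
  unfolding window_energy_def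
  by (subst integral_shift[where a = t, symmetric], rule Bochner_Integration.integral_cong)
     (auto split: split_indicator)

lemma window_energy_nonneg: "0 \<le> window_energy t" by (simp add: window_energy_def)

lemma window_L1_square_le: "(window_L1 t)\<^sup>2 \<le> N * window_energy t"
  using cauchy_schwarz_interval[OF b_shift_integrable(1,3), of 0 N t] N_pos by (simp add: window_L1_def window_energy_shift)

section \<open>Bounds on the two integral parts and inversion of the transform\<close>

lemma kernel_part_le: "\<bar>kernel_part s t\<bar> \<le> \<kappa> * (LINT q|lborel. indicator {s..} q * \<bar>xT q t\<bar>)"
proof -
  have i: "integrable lborel (\<lambda>q. indicator {s..} q * \<bar>xT q t\<bar>)"
    using integrable_mult_indicator[OF _ integrable_abs[OF xT_integrable[of t]], of "{s..}"] by simp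
  have "\<bar>kernel_part s t\<bar> \<le> (LINT q|lborel. \<bar>KT s q * xT q t\<bar>)"
    unfolding kernel_part_def by (rule integral_abs_bound)
  also have "\<dots> \<le> (LINT q|lborel. \<kappa> * (indicator {s..} q * \<bar>xT q t\<bar>))"
  proof (rule integral_mono[OF integrable_abs[OF KT_xT_integrable] integrable_mult_right[OF i]])
    fix q show "\<bar>KT s q * xT q t\<bar> \<le> \<kappa> * (indicator {s..} q * \<bar>xT q t\<bar>)"
      using \<kappa>_bounds(3)[of s q] by (cases "s \<le> q") (auto simp: abs_mult KT_outside T1_def intro!: mult_right_mono)
  qed
  finally show ?thesis by simp
qed

lemma kernel_part_le_X: "\<bar>kernel_part s t\<bar> \<le> \<kappa> * x_L1 t"
proof -
  have i: "integrable lborel (\<lambda>q. indicator {s..} q * \<bar>xT q t\<bar>)"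
    using integrable_mult_indicator[OF _ integrable_abs[OF xT_integrable[of t]], of "{s..}"] by simp
  have "(LINT q|lborel. indicator {s..} q * \<bar>xT q t\<bar>) \<le> x_L1 t"
    unfolding x_L1_def by (intro integral_mono i integrable_abs xT_integrable) (auto split: split_indicator)
  with kernel_part_le[of s t] \<kappa>_bounds(1) show ?thesis by (meson mult_left_mono less_imp_le order_trans)
qed

lemma kernel_part_outside: "s \<notin> {0..1} \<Longrightarrow> kernel_part s t = 0"
proof -
  assume "s \<notin> {0..1}"
  then have *: "KT s q * xT q t = 0" for q by (auto simp: KT_outside T1_def)
  show ?thesis unfolding kernel_part_def * by simp
qed

lemma kernel_part_measurable[measurable]: "(\<lambda>s. kernel_part s t) \<in> borel_measurable borel"
  unfolding kernel_part_def by measurable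

lemma delay_part_le: "\<bar>delay_part s t\<bar> \<le> \<mu> * (LINT \<sigma>|lborel. indicator {0..\<tau>} \<sigma> * \<bar>b (t + \<sigma>)\<bar>)"
proof -
  have "\<bar>delay_part s t\<bar> \<le> (LINT \<sigma>|lborel. \<bar>indicator {0..\<tau>} \<sigma> * (JT (s + \<sigma>) * b (t + \<sigma>))\<bar>)"
    unfolding delay_part_def by (rule integral_abs_bound)
  also have "\<dots> \<le> (LINT \<sigma>|lborel. \<mu> * (indicator {0..\<tau>} \<sigma> * \<bar>b (t + \<sigma>)\<bar>))"
    by (rule integral_mono[OF integrable_abs[OF JT_b_integrable] integrable_mult_right[OF b_shift_integrable(2)]])
       (use JT_le in \<open>auto simp: abs_mult mult_right_mono split: split_indicator\<close>)
  finally show ?thesis by simp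
qed

lemma delay_part_le_M: "\<bar>delay_part s t\<bar> \<le> \<mu> * window_L1 t"
proof -
  have "(LINT \<sigma>|lborel. indicator {0..\<tau>} \<sigma> * \<bar>b (t + \<sigma>)\<bar>) \<le> window_L1 t"
    by (rule b_window_mono) (simp_all add: N_def)
  then show ?thesis
    using mult_left_mono[OF _ less_imp_le[OF \<mu>_pos]] by (blast intro: order.trans[OF delay_part_le])
qed

lemma x_minus_A_le:
  assumes "0 \<le> t"
  shows "AE s in lborel. \<bar>xT s t - kernel_part s t\<bar> \<le> indicator {0..1} s * (\<bar>b (t + (N - s))\<bar> + \<mu> * window_L1 t)"
  using AE_lborel_singleton[of 1]
proof eventually_elim
  case (elim s)
  show ?case
  proof (cases "s \<in> {0..1}")
    case True
    then show ?thesis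
      using backstepping_transform_eq_b[of s t] delay_part_le_M[of s t] elim assms by (auto simp: xT_def N_def)
  qed (simp add: kernel_part_outside, simp add: xT_def)
qed

text \<open>Reflection takes the unit interval to the last unit of the window, the segment of
  \<open>b\<close> that encodes x. Below, \<open>g\<close> is the absolute value or the
  square.\<close>

lemma reflected_window:
  "integrable lborel (\<lambda>s. indicator {0..1} s * g (b (t + (N - s))))
     \<longleftrightarrow> integrable lborel (\<lambda>\<sigma>. indicator {\<tau>..N} \<sigma> * g (b (t + \<sigma>)))"
  "(LINT s|lborel. indicator {0..1} s * g (b (t + (N - s)))) = (LINT \<sigma>|lborel. indicator {\<tau>..N} \<sigma> * g (b (t + \<sigma>)))"
  for g :: "real \<Rightarrow> real"
proof -
  have eq: "(\<lambda>s. indicator {0..1} s * g (b (t + (N - s)))) = (\<lambda>s. indicator {\<tau>..N} (N - s) * g (b (t + (N - s))))"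
    by (auto simp: fun_eq_iff N_def split: split_indicator)
  show "integrable lborel (\<lambda>s. indicator {0..1} s * g (b (t + (N - s))))
     \<longleftrightarrow> integrable lborel (\<lambda>\<sigma>. indicator {\<tau>..N} \<sigma> * g (b (t + \<sigma>)))"
    unfolding eq by (rule integrable_reflect[where g = "\<lambda>\<sigma>. indicator {\<tau>..N} \<sigma> * g (b (t + \<sigma>))"])
  show "(LINT s|lborel. indicator {0..1} s * g (b (t + (N - s)))) = (LINT \<sigma>|lborel. indicator {\<tau>..N} \<sigma> * g (b (t + \<sigma>)))"
    unfolding eq by (rule integral_reflect[where g = "\<lambda>\<sigma>. indicator {\<tau>..N} \<sigma> * g (b (t + \<sigma>))"])
qed

lemma kernel_part_integrable: "integrable lborel (\<lambda>s. kernel_part s t)"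
proof (rule integrable_bounded_interval)
  show "\<bar>kernel_part s t\<bar> \<le> \<kappa> * x_L1 t * indicator {0..1} s" for s
    using kernel_part_le_X[of s t] by (cases "s \<in> {0..1}") (simp_all add: kernel_part_outside)
qed measurable

text \<open>x minus its Volterra part is bounded by \<open>b\<close> on the last unit plus a
  constant from the delay part; \<open>volterra_L1_bound\<close> recovers x from that difference,
  since \<open>kernel_part_le\<close> keeps the tail from \<open>s\<close>.\<close>

lemma x_L1_le_M:
  assumes "0 \<le> t"
  shows "x_L1 t \<le> Cx * window_L1 t"
proof -
  have i1: "integrable lborel (\<lambda>s. indicator {0..1} s * \<bar>b (t + (N - s))\<bar>)"
    using reflected_window(1)[of abs t] b_shift_integrable(2) by blast
  have "(LINT s|lborel. \<bar>xT s t - kernel_part s t\<bar>) \<le> (LINT s|lborel. indicator {0..1} s * \<bar>b (t + (N - s))\<bar> + \<mu> * window_L1 t * indicator {0..1} s)"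
    using xT_integrable kernel_part_integrable i1 integrable_indicator_Icc
  proof (intro integral_mono_AE)
    show "AE s in lborel. \<bar>xT s t - kernel_part s t\<bar> \<le> indicator {0..1} s * \<bar>b (t + (N - s))\<bar> + \<mu> * window_L1 t * indicator {0..1} s"
      using x_minus_A_le[OF assms] by eventually_elim (simp add: algebra_simps)
  qed auto
  also have "\<dots> = (LINT \<sigma>|lborel. indicator {\<tau>..N} \<sigma> * \<bar>b (t + \<sigma>)\<bar>) + \<mu> * window_L1 t"
    using i1 integrable_indicator_Icc[of 0 1] by (simp add: reflected_window(2)[of abs])
  also have "\<dots> \<le> (1 + \<mu>) * window_L1 t"
    using b_window_mono[of \<tau> N t] \<tau>_pos by (simp add: algebra_simps)
  finally have *: "(LINT s|lborel. \<bar>xT s t - kernel_part s t\<bar>) \<le> (1 + \<mu>) * window_L1 t" .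
  have "x_L1 t \<le> 2 * exp (2 * \<kappa>) * (LINT s|lborel. \<bar>xT s t - kernel_part s t\<bar>)"
    unfolding x_L1_def
    by (rule volterra_L1_bound) (use xT_integrable \<kappa>_bounds(1) kernel_part_outside kernel_part_le in \<open>auto simp: xT_def\<close>)
  also have "\<dots> \<le> 2 * exp (2 * \<kappa>) * ((1 + \<mu>) * window_L1 t)"
    using * by (intro mult_left_mono) auto
  finally show ?thesis by (simp add: Cx_def mult.assoc)
qed

text \<open>The L1 bound controls \<open>kernel_part\<close> uniformly in \<open>s\<close>, so a
  second Volterra inversion in L2 is avoided: squaring a pointwise bound by \<open>b\<close> plus a
  constant suffices.\<close>

lemma x_norm_le:
  assumes "0 \<le> t"
  shows "(LINT s|lborel. (xT s t)\<^sup>2) \<le> (2 + 2 * (\<mu> + \<kappa> * Cx)\<^sup>2 * N) * window_energy t"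
proof -
  let ?c = "(\<mu> + \<kappa> * Cx) * window_L1 t"
  have i1: "integrable lborel (\<lambda>s. indicator {0..1} s * (b (t + (N - s)))\<^sup>2)"
    using reflected_window(1)[of "\<lambda>y. y\<^sup>2" t] b_shift_integrable(3) by blast
  have "(LINT s|lborel. (xT s t)\<^sup>2)
      \<le> (LINT s|lborel. 2 * (indicator {0..1} s * (b (t + (N - s)))\<^sup>2) + 2 * ?c\<^sup>2 * indicator {0..1} s)"
  proof (rule integral_mono_AE)
    show "AE s in lborel. (xT s t)\<^sup>2 \<le> 2 * (indicator {0..1} s * (b (t + (N - s)))\<^sup>2) + 2 * ?c\<^sup>2 * indicator {0..1} s"
      using x_minus_A_le[OF assms]
    proof eventually_elim
      case (elim s)
      show ?case
      proof (cases "s \<in> {0..1}")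
        case True
        have "\<kappa> * x_L1 t \<le> \<kappa> * (Cx * window_L1 t)"
          using x_L1_le_M[OF assms] \<kappa>_bounds(1) by (intro mult_left_mono) auto
        then have "\<bar>xT s t\<bar> \<le> \<bar>b (t + (N - s))\<bar> + ?c"
          using elim True kernel_part_le_X[of s t] by (simp add: algebra_simps)
        from sum_square_le[OF this] True show ?thesis by simp
      qed (simp add: xT_def)
    qed
  qed (use xT_square_integrable i1 integrable_indicator_Icc in auto)
  also have "\<dots> = 2 * (LINT \<sigma>|lborel. indicator {\<tau>..N} \<sigma> * (b (t + \<sigma>))\<^sup>2) + 2 * ?c\<^sup>2"
    using i1 integrable_indicator_Icc[of 0 1] by (simp add: reflected_window(2)[of "\<lambda>y. y\<^sup>2"])
  also have "(LINT \<sigma>|lborel. indicator {\<tau>..N} \<sigma> * (b (t + \<sigma>))\<^sup>2) \<le> window_energy t"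
    unfolding window_energy_shift
    by (intro integral_mono b_shift_integrable) (use \<tau>_pos in \<open>auto split: split_indicator\<close>)
  also have "?c\<^sup>2 \<le> (\<mu> + \<kappa> * Cx)\<^sup>2 * (N * window_energy t)"
    unfolding power_mult_distrib using window_L1_square_le by (intro mult_left_mono) auto
  finally show ?thesis by (simp add: algebra_simps)
qed

text \<open>Agreement is asked only for \<open>0 < r\<close>, because the outlet value of v at time
  0 may differ from the trace.\<close>

lemma delay_line_norm:
  assumes "L2_01 z" and "0 < l" and "\<And>r. 0 < r \<Longrightarrow> r \<le> 1 \<Longrightarrow> z r = b (t + (a + l * r))"
  shows "L2norm2 z = (LINT \<sigma>|lborel. indicator {a..a + l} \<sigma> * (b (t + \<sigma>))\<^sup>2) / l"
proof -
  have "L2norm2 z = (LINT r|lborel. indicator {0..1} r * (b (t + (a + l * r)))\<^sup>2)"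
    unfolding L2norm2_def set_lebesgue_integral_def
  proof (rule integral_cong_AE)
    show "(\<lambda>r. indicator {0..1} r *\<^sub>R (z r)\<^sup>2) \<in> borel_measurable lborel"
      using assms(1) unfolding L2_01_def set_integrable_def by (blast dest: borel_measurable_integrable)
    show "AE r in lborel. indicator {0..1} r *\<^sub>R (z r)\<^sup>2 = indicator {0..1} r * (b (t + (a + l * r)))\<^sup>2"
      using AE_lborel_singleton[of 0]
      by eventually_elim (use assms(3) in \<open>auto split: split_indicator\<close>)
  qed measurable
  then show ?thesis
    using integral_interval_affine[OF assms(2), of a "\<lambda>\<sigma>. (b (t + \<sigma>))\<^sup>2"] assms(2) by simp
qed

lemma state_L2:
  assumes "0 \<le> t"
  shows "L2_01 (\<lambda>s. x s t)" "L2_01 (\<lambda>s. v s t)" "L2_01 (\<lambda>s. u s t)"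
  using regular assms by (simp_all add: state_regular_def)

lemma norm_x_eq:
  assumes "0 \<le> t"
  shows "L2norm2 (\<lambda>s. x s t) = (LINT s|lborel. (xT s t)\<^sup>2)"
  unfolding L2norm2_def set_lebesgue_integral_def
  by (rule Bochner_Integration.integral_cong) (use assms in \<open>auto simp: xT_def split: split_indicator\<close>)

lemma norm_v_eq:
  assumes "0 \<le> t"
  shows "L2norm2 (\<lambda>s. v s t) = (LINT \<sigma>|lborel. indicator {\<eta>..\<tau>} \<sigma> * (b (t + \<sigma>))\<^sup>2) / h"
proof -
  have "v r t = b (t + (\<eta> + h * r))" if "0 < r" "r \<le> 1" for r
    using v_eq_b[of r t] that assms by (simp add: add.assoc)
  then show ?thesis
    using delay_line_norm[OF state_L2(2)[OF assms] h_pos, of t \<eta>] by (simp add: \<eta>_plus_h)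
qed

lemma norm_u_eq:
  assumes "0 \<le> t"
  shows "L2norm2 (\<lambda>s. u s t) = (LINT \<sigma>|lborel. indicator {0..\<eta>} \<sigma> * (b (t + \<sigma>))\<^sup>2) / \<eta>"
proof -
  have "u r t = b (t + (0 + \<eta> * r))" if "0 < r" "r \<le> 1" for r
    using u_eq_b[of r t] that assms by simp
  then show ?thesis
    using delay_line_norm[OF state_L2(3)[OF assms] \<eta>_pos, of t 0] by simp
qed

definition energy :: "real \<Rightarrow> real"
  where "energy t = L2norm2 (\<lambda>s. x s t) + L2norm2 (\<lambda>s. v s t) + L2norm2 (\<lambda>s. u s t)"

lemma energy_0: "energy 0 = L2norm2 x0 + L2norm2 v0 + L2norm2 u0"
proof -
  have "(LBINT r:{0..0}. g r) = 0" for g :: "real \<Rightarrow> real"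
    unfolding set_lebesgue_integral_def
    by (rule integral_eq_zero_AE, rule eventually_mono[OF AE_lborel_singleton[of 0]]) auto
  then have "x s 0 = x0 s" "v s 0 = v0 s" "u s 0 = u0 s" if "s \<in> {0..1}" for s
    using x_sol[of s 0] v_sol[of s 0] u_sol[of s 0] that by simp_all
  then have "indicator {0..1} s *\<^sub>R (x s 0)\<^sup>2 = indicator {0..1} s *\<^sub>R (x0 s)\<^sup>2"
    "indicator {0..1} s *\<^sub>R (v s 0)\<^sup>2 = indicator {0..1} s *\<^sub>R (v0 s)\<^sup>2"
    "indicator {0..1} s *\<^sub>R (u s 0)\<^sup>2 = indicator {0..1} s *\<^sub>R (u0 s)\<^sup>2" for s
    by (auto split: split_indicator)
  then show ?thesis by (simp only: energy_def L2norm2_def set_lebesgue_integral_def)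
qed

lemma window_split:
  assumes "a \<le> d" "d \<le> e"
  shows "(LINT \<sigma>|lborel. indicator {a..d} \<sigma> * (b (t + \<sigma>))\<^sup>2) + (LINT \<sigma>|lborel. indicator {d..e} \<sigma> * (b (t + \<sigma>))\<^sup>2)
    = (LINT \<sigma>|lborel. indicator {a..e} \<sigma> * (b (t + \<sigma>))\<^sup>2)"
  by (rule integral_interval_combine[OF b_shift_integrable(3) assms])

lemma delay_energy:
  assumes "0 \<le> t"
  shows "(LINT \<sigma>|lborel. indicator {0..\<tau>} \<sigma> * (b (t + \<sigma>))\<^sup>2) = \<eta> * L2norm2 (\<lambda>s. u s t) + h * L2norm2 (\<lambda>s. v s t)"
proof -
  from window_split[OF less_imp_le[OF \<eta>_pos] \<eta>_le_\<tau>, of t] show ?thesis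
    unfolding norm_u_eq[OF assms] norm_v_eq[OF assms] using \<eta>_pos h_pos by simp
qed

lemma L2norm2_nonneg: "0 \<le> L2norm2 g"
  by (simp add: L2norm2_def set_lebesgue_integral_def)

lemma energy_le_window_energy:
  assumes "0 \<le> t"
  shows "energy t \<le> (2 + 2 * (\<mu> + \<kappa> * Cx)\<^sup>2 * N + 1 / h + 1 / \<eta>) * window_energy t"
proof -
  have part: "(LINT \<sigma>|lborel. indicator {a..d} \<sigma> * (b (t + \<sigma>))\<^sup>2) \<le> window_energy t" if "0 \<le> a" "d \<le> N" for a d
    unfolding window_energy_shift by (intro integral_mono b_shift_integrable) (use that in \<open>auto split: split_indicator\<close>)
  have "\<tau> \<le> N" "\<eta> \<le> N" using h_pos by (simp_all add: N_def \<eta>_def)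
  then have "L2norm2 (\<lambda>s. v s t) \<le> window_energy t / h" "L2norm2 (\<lambda>s. u s t) \<le> window_energy t / \<eta>"
    unfolding norm_v_eq[OF assms] norm_u_eq[OF assms]
    using \<eta>_pos h_pos by (auto intro!: divide_right_mono part)
  then show ?thesis
    using x_norm_le[OF assms] by (simp add: energy_def norm_x_eq[OF assms] distrib_right)
qed

text \<open>This direction uses the forward transform alone: the delays fill
  \<open>[0, \<tau>]\<close> exactly, and on the last unit \<open>b\<close> is x minus two integral
  terms that the state controls.\<close>

lemma window_energy_le_S:
  assumes "0 \<le> t"
  shows "window_energy t \<le> (2 + 4 * \<kappa>\<^sup>2 + (1 + 4 * \<mu>\<^sup>2 * \<tau>) * \<tau>) * energy t"
proof -
  \<comment> \<open>The delay part is estimated over \<open>[0, \<tau>]\<close> and not over the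
    whole window, whose last unit is the quantity to be bounded.\<close>
  let ?M0 = "LINT \<sigma>|lborel. indicator {0..\<tau>} \<sigma> * \<bar>b (t + \<sigma>)\<bar>"
  let ?D = "LINT \<sigma>|lborel. indicator {0..\<tau>} \<sigma> * (b (t + \<sigma>))\<^sup>2"
  let ?x = "LINT s|lborel. (xT s t)\<^sup>2"
  have i1: "integrable lborel (\<lambda>s. indicator {0..1} s * (b (t + (N - s)))\<^sup>2)"
    using reflected_window(1)[of "\<lambda>y. y\<^sup>2" t] b_shift_integrable(3) by blast
  have xT_ind: "indicator {0..1} q * g (xT q t) = g (xT q t)" if "g 0 = 0" for q and g :: "real \<Rightarrow> real"
    using that by (auto simp: xT_def split: split_indicator)
  have X2: "(x_L1 t)\<^sup>2 \<le> ?x"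
    using cauchy_schwarz_interval[of 0 1 "\<lambda>q. xT q t"] xT_integrable xT_square_integrable
    by (simp add: xT_ind[of "\<lambda>y. y"] xT_ind[of abs] xT_ind[of "\<lambda>y. y\<^sup>2"] x_L1_def)
  have M2: "?M0\<^sup>2 \<le> \<tau> * ?D"
    using cauchy_schwarz_interval[OF b_shift_integrable(1,3), of 0 \<tau> t] \<tau>_pos by simp
  have "(\<kappa> * x_L1 t + \<mu> * ?M0)\<^sup>2 \<le> 2 * (\<kappa> * x_L1 t)\<^sup>2 + 2 * (\<mu> * ?M0)\<^sup>2"
    using x_L1_nonneg \<kappa>_bounds(1) \<mu>_pos by (intro sum_square_le) simp
  also have "(\<kappa> * x_L1 t)\<^sup>2 \<le> \<kappa>\<^sup>2 * ?x" unfolding power_mult_distrib using X2 by (intro mult_left_mono) auto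
  also have "(\<mu> * ?M0)\<^sup>2 \<le> \<mu>\<^sup>2 * (\<tau> * ?D)" unfolding power_mult_distrib using M2 by (intro mult_left_mono) auto
  finally have c: "(\<kappa> * x_L1 t + \<mu> * ?M0)\<^sup>2 \<le> 2 * (\<kappa>\<^sup>2 * ?x) + 2 * (\<mu>\<^sup>2 * (\<tau> * ?D))" by simp
  have "(LINT s|lborel. indicator {0..1} s * (b (t + (N - s)))\<^sup>2)
      \<le> (LINT s|lborel. 2 * (xT s t)\<^sup>2 + 2 * (\<kappa> * x_L1 t + \<mu> * ?M0)\<^sup>2 * indicator {0..1} s)"
  proof (rule integral_mono_AE)
    show "AE s in lborel. indicator {0..1} s * (b (t + (N - s)))\<^sup>2
        \<le> 2 * (xT s t)\<^sup>2 + 2 * (\<kappa> * x_L1 t + \<mu> * ?M0)\<^sup>2 * indicator {0..1} s"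
      using AE_lborel_singleton[of 1]
    proof eventually_elim
      case (elim s)
      show ?case
      proof (cases "s \<in> {0..1}")
        case True
        have "\<bar>b (t + (N - s))\<bar> \<le> \<bar>xT s t\<bar> + (\<kappa> * x_L1 t + \<mu> * ?M0)"
          using backstepping_transform_eq_b[of s t] kernel_part_le_X[of s t] delay_part_le[of s t] True elim assms
          by (simp add: xT_def N_def)
        from sum_square_le[OF this] True show ?thesis by simp
      qed simp
    qed
  qed (use xT_square_integrable i1 integrable_indicator_Icc in auto)
  also have "\<dots> = 2 * ?x + 2 * (\<kappa> * x_L1 t + \<mu> * ?M0)\<^sup>2"
    using xT_square_integrable integrable_indicator_Icc[of 0 1] by simp
  finally have R: "(LINT \<sigma>|lborel. indicator {\<tau>..N} \<sigma> * (b (t + \<sigma>))\<^sup>2) \<le> 2 * ?x + 2 * (\<kappa> * x_L1 t + \<mu> * ?M0)\<^sup>2"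
    by (simp add: reflected_window(2)[of "\<lambda>y. y\<^sup>2"])
  have D: "?D \<le> \<tau> * energy t"
  proof -
    have "?D \<le> \<tau> * L2norm2 (\<lambda>s. u s t) + \<tau> * L2norm2 (\<lambda>s. v s t)"
      unfolding delay_energy[OF assms] using L2norm2_nonneg h_pos \<eta>_pos
      using h_less \<eta>_le_\<tau> by (intro add_mono mult_right_mono) auto
    also have "\<dots> \<le> \<tau> * energy t"
      using L2norm2_nonneg \<tau>_pos unfolding distrib_left[symmetric] by (intro mult_left_mono) (auto simp: energy_def)
    finally show ?thesis .
  qed
  have "?x \<le> energy t" using L2norm2_nonneg by (simp add: energy_def norm_x_eq[OF assms])
  have "window_energy t = ?D + (LINT \<sigma>|lborel. indicator {\<tau>..N} \<sigma> * (b (t + \<sigma>))\<^sup>2)"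
    using window_split[of 0 \<tau> N t] \<tau>_pos by (simp add: window_energy_shift N_def)
  also have "\<dots> \<le> (2 + 4 * \<kappa>\<^sup>2) * ?x + (1 + 4 * \<mu>\<^sup>2 * \<tau>) * ?D"
    using R c by (simp add: algebra_simps)
  also have "\<dots> \<le> (2 + 4 * \<kappa>\<^sup>2) * energy t + (1 + 4 * \<mu>\<^sup>2 * \<tau>) * (\<tau> * energy t)"
    using D \<open>?x \<le> energy t\<close> \<tau>_pos by (intro add_mono mult_left_mono) auto
  finally show ?thesis by (simp add: algebra_simps)
qed

end

section \<open>Decay under approximate feedback\<close>

locale approximate_feedback = solution +
  fixes \<epsilon> :: real
  assumes Kh_cont: "continuous_on T1 (\<lambda>p. Kh (fst p) (snd p))"
    and Lh_cont: "continuous_on {0..h} Lh" and Jh_cont: "continuous_on {0..\<tau> - h} Jh"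
    and K_close: "\<And>q. q \<in> {0..1} \<Longrightarrow> \<bar>K 0 q - Kh 0 q\<bar> \<le> \<epsilon>"
    and L_close: "\<And>\<phi>. \<phi> \<in> {0..h} \<Longrightarrow> \<bar>kernel_L h \<tau> c K \<phi> - Lh \<phi>\<bar> \<le> \<epsilon>"
    and J_close: "\<And>\<sigma>. \<sigma> \<in> {0..\<tau> - h} \<Longrightarrow> \<bar>kernel_J c K \<sigma> - Jh \<sigma>\<bar> \<le> \<epsilon>"
    and \<epsilon>_nonneg: "0 \<le> \<epsilon>" and \<epsilon>_small: "\<epsilon> * (2 * (1 + Cx) * N) \<le> 1"
begin

lemma feedback_eq:
  assumes "0 < t"
  shows "x 0 t = (LINT q|lborel. indicator {0..1} q * (Kh 0 q * xT q t))
     + (LINT \<sigma>|lborel. indicator {\<eta>..\<tau>} \<sigma> * (Lh (\<sigma> - \<eta>) * b (t + \<sigma>)))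
     + (LINT \<sigma>|lborel. indicator {0..\<eta>} \<sigma> * (Jh \<sigma> * b (t + \<sigma>)))"
proof -
  \<comment> \<open>At the inlet the characteristic has length zero, so the mild formula returns the
    control itself.\<close>
  have "(LBINT r:{t..t}. g r) = 0" for g :: "real \<Rightarrow> real"
    unfolding set_lebesgue_integral_def
    by (rule integral_eq_zero_AE, rule eventually_mono[OF AE_lborel_singleton[of t]]) auto
  then have "x 0 t = feedback_U h \<tau> Kh Lh Jh x v u t"
    using x_sol[of 0 t] assms by simp
  moreover have "(LBINT q:{0..1}. Kh 0 q * x q t) = (LINT q|lborel. indicator {0..1} q * (Kh 0 q * xT q t))"
    unfolding set_lebesgue_integral_def
    by (rule Bochner_Integration.integral_cong) (use assms in \<open>auto simp: xT_def split: split_indicator\<close>)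
  moreover have "h * (LBINT r:{0..1}. Lh (h * r) * v r t)
      = (LINT \<sigma>|lborel. indicator {\<eta>..\<tau>} \<sigma> * (Lh (\<sigma> - \<eta>) * b (t + \<sigma>)))"
  proof -
    have "(LINT \<sigma>|lborel. indicator {\<eta>..\<eta> + h} \<sigma> * (Lh (\<sigma> - \<eta>) * b (t + \<sigma>)))
        = h * (LINT r|lborel. indicator {0..1} r * (Lh (\<eta> + h * r - \<eta>) * b (t + (\<eta> + h * r))))"
      by (rule integral_interval_affine[OF h_pos])
    also have "(LINT r|lborel. indicator {0..1} r * (Lh (\<eta> + h * r - \<eta>) * b (t + (\<eta> + h * r))))
        = (LBINT r:{0..1}. Lh (h * r) * v r t)"
      unfolding set_lebesgue_integral_def
      by (rule Bochner_Integration.integral_cong)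
         (use assms v_eq_b in \<open>auto simp: add.assoc split: split_indicator\<close>)
    finally show ?thesis by (simp add: \<eta>_plus_h)
  qed
  moreover have "(\<tau> - h) * (LBINT r:{0..1}. Jh ((\<tau> - h) * r) * u r t)
      = (LINT \<sigma>|lborel. indicator {0..\<eta>} \<sigma> * (Jh \<sigma> * b (t + \<sigma>)))"
  proof -
    have "(LINT \<sigma>|lborel. indicator {0..0 + \<eta>} \<sigma> * (Jh \<sigma> * b (t + \<sigma>)))
        = \<eta> * (LINT r|lborel. indicator {0..1} r * (Jh (0 + \<eta> * r) * b (t + (0 + \<eta> * r))))"
      by (rule integral_interval_affine[OF \<eta>_pos])
    also have "(LINT r|lborel. indicator {0..1} r * (Jh (0 + \<eta> * r) * b (t + (0 + \<eta> * r))))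
        = (LBINT r:{0..1}. Jh (\<eta> * r) * u r t)"
      unfolding set_lebesgue_integral_def
      by (rule Bochner_Integration.integral_cong)
         (use assms u_eq_b in \<open>auto split: split_indicator\<close>)
    finally show ?thesis by (simp add: \<eta>_def)
  qed
  ultimately show ?thesis by (simp add: feedback_U_def)
qed

text \<open>Exact kernels would cancel both integral terms of the transform at the inlet; what
  remains is the kernel error. The summand \<open>Cx\<close> accounts for the error acting on x, the
  summand 1 for the error acting on the delays.\<close>

lemma inflow_le:
  assumes "0 < t"
  shows "\<bar>b (t + N)\<bar> \<le> \<epsilon> * ((1 + Cx) * window_L1 t)"
proof -
  let ?I = "\<lambda>a d k. LINT \<sigma>|lborel. indicator {a..d} \<sigma> * (k \<sigma> * b (t + \<sigma>))"
  have xT1: "integrable lborel (\<lambda>q. indicator {0..1} q * xT q t)"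
    using integrable_mult_indicator[OF _ xT_integrable[of t], of "{0..1}"] by simp
  have cont0: "continuous_on {0..1} (\<lambda>q. g 0 q)" if "continuous_on T1 (\<lambda>p. g (fst p) (snd p))"
    for g :: "real \<Rightarrow> real \<Rightarrow> real"
  proof -
    have "continuous_on {0..1} (\<lambda>q::real. (0::real, q))" by (intro continuous_intros)
    moreover have "(\<lambda>q. (0, q)) ` {0..1} \<subseteq> T1" by (auto simp: T1_def)
    ultimately show ?thesis using continuous_on_compose2[OF that] by fastforce
  qed
  have A0: "kernel_part 0 t = (LINT q|lborel. indicator {0..1} q * (K 0 q * xT q t))"
    unfolding kernel_part_def by (rule Bochner_Integration.integral_cong) (auto simp: KT_def T1_def split: split_indicator)
  have P1: "\<bar>(LINT q|lborel. indicator {0..1} q * (Kh 0 q * xT q t)) - kernel_part 0 t\<bar>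
      \<le> \<epsilon> * (LINT q|lborel. indicator {0..1} q * \<bar>xT q t\<bar>)"
    unfolding A0
    by (rule integral_interval_perturbation[OF integrable_continuous_times integrable_continuous_times])
       (use cont0 Kh_cont K_cont xT1 K_close in \<open>auto simp: abs_minus_commute\<close>)
  have JTi: "integrable lborel (\<lambda>\<sigma>. indicator {a..d} \<sigma> * (JT \<sigma> * b (t + \<sigma>)))" for a d
    using JT_b_integrable[of a d 0 t] by simp
  have P2: "\<bar>?I \<eta> \<tau> (\<lambda>\<sigma>. Lh (\<sigma> - \<eta>)) - ?I \<eta> \<tau> JT\<bar> \<le> \<epsilon> * (LINT \<sigma>|lborel. indicator {\<eta>..\<tau>} \<sigma> * \<bar>b (t + \<sigma>)\<bar>)"
  proof (rule integral_interval_perturbation[OF JTi integrable_continuous_times b_shift_integrable(1)])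
    show "continuous_on {\<eta>..\<tau>} (\<lambda>\<sigma>. Lh (\<sigma> - \<eta>))"
      by (rule continuous_on_compose2[OF Lh_cont]) (auto intro!: continuous_intros simp: \<eta>_def)
    show "\<bar>Lh (\<sigma> - \<eta>) - JT \<sigma>\<bar> \<le> \<epsilon>" if "\<sigma> \<in> {\<eta>..\<tau>}" for \<sigma>
      using L_close[of "\<sigma> - \<eta>"] kernel_L_eq_JT[of "\<sigma> - \<eta>"] that
      by (simp add: abs_minus_commute \<eta>_def)
  qed (rule b_shift_integrable)
  have P3: "\<bar>?I 0 \<eta> Jh - ?I 0 \<eta> JT\<bar> \<le> \<epsilon> * (LINT \<sigma>|lborel. indicator {0..\<eta>} \<sigma> * \<bar>b (t + \<sigma>)\<bar>)"
  proof (rule integral_interval_perturbation[OF JTi integrable_continuous_times b_shift_integrable(1)])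
    show "continuous_on {0..\<eta>} Jh" using Jh_cont by (simp add: \<eta>_def)
    show "\<bar>Jh \<sigma> - JT \<sigma>\<bar> \<le> \<epsilon>" if "\<sigma> \<in> {0..\<eta>}" for \<sigma>
      using J_close[of \<sigma>] kernel_J_eq_JT[of \<sigma>] that by (simp add: abs_minus_commute \<eta>_def)
  qed (rule b_shift_integrable)
  have B0: "delay_part 0 t = ?I 0 \<eta> JT + ?I \<eta> \<tau> JT"
    using integral_interval_combine[OF JTi, of 0 \<eta> \<tau>] \<eta>_pos \<eta>_le_\<tau> by (simp add: delay_part_def)
  have M0: "(LINT \<sigma>|lborel. indicator {0..\<eta>} \<sigma> * \<bar>b (t + \<sigma>)\<bar>) + (LINT \<sigma>|lborel. indicator {\<eta>..\<tau>} \<sigma> * \<bar>b (t + \<sigma>)\<bar>) \<le> window_L1 t"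
    using integral_interval_combine[OF b_shift_integrable(2), of 0 \<eta> \<tau> t] b_window_mono[of 0 \<tau> t] \<eta>_pos \<eta>_le_\<tau>
    by (simp add: N_def)
  have "(LINT q|lborel. indicator {0..1} q * \<bar>xT q t\<bar>) \<le> x_L1 t"
    unfolding x_L1_def
    using integrable_abs[OF xT1] xT_integrable
    by (intro integral_mono) (auto simp: abs_mult split: split_indicator)
  then have "(LINT q|lborel. indicator {0..1} q * \<bar>xT q t\<bar>) \<le> Cx * window_L1 t"
    using x_L1_le_M[of t] assms by simp
  with M0 have "\<epsilon> * (LINT q|lborel. indicator {0..1} q * \<bar>xT q t\<bar>)
      + (\<epsilon> * (LINT \<sigma>|lborel. indicator {0..\<eta>} \<sigma> * \<bar>b (t + \<sigma>)\<bar>) + \<epsilon> * (LINT \<sigma>|lborel. indicator {\<eta>..\<tau>} \<sigma> * \<bar>b (t + \<sigma>)\<bar>))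
      \<le> \<epsilon> * ((1 + Cx) * window_L1 t)"
    unfolding distrib_left[symmetric] by (intro mult_left_mono \<epsilon>_nonneg) (simp add: algebra_simps)
  moreover have "b (t + N) = x 0 t - kernel_part 0 t - delay_part 0 t"
    using backstepping_transform_eq_b[of 0 t] assms by (simp add: N_def)
  ultimately show ?thesis
    using P1 P2 P3 unfolding feedback_eq[OF assms] B0 by linarith
qed

text \<open>The smallness of \<open>\<epsilon>\<close> is calibrated here: the square of
  \<open>1 / (2 * N)\<close> times the factor \<open>N\<close> from Cauchy-Schwarz is
  \<open>1 / (4 * N)\<close>, so integration over a window will give a quarter.\<close>

lemma inflow_square_le:
  assumes "0 < t"
  shows "(b (t + N))\<^sup>2 \<le> window_energy t / (4 * N)"
proof -
  have "\<epsilon> * (1 + Cx) \<le> 1 / (2 * N)" using \<epsilon>_small N_pos by (simp add: field_simps)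
  then have "(\<epsilon> * (1 + Cx))\<^sup>2 \<le> (1 / (2 * N))\<^sup>2"
    using \<epsilon>_nonneg Cx_pos by (intro power_mono) auto
  moreover have "(b (t + N))\<^sup>2 \<le> (\<epsilon> * ((1 + Cx) * window_L1 t))\<^sup>2"
    using inflow_le[OF assms] by (metis abs_ge_zero power2_abs power_mono)
  then have "(b (t + N))\<^sup>2 \<le> (\<epsilon> * (1 + Cx))\<^sup>2 * (window_L1 t)\<^sup>2" by (simp add: power_mult_distrib mult.assoc)
  ultimately have "(b (t + N))\<^sup>2 \<le> (1 / (2 * N))\<^sup>2 * (N * window_energy t)"
    using window_L1_square_le[of t] by (blast intro: order.trans mult_mono zero_le_power2)
  then show ?thesis using N_pos by (simp add: power2_eq_square field_simps)
qed

lemma window_energy_le_two_windows: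
  assumes "0 \<le> \<sigma>" "\<sigma> \<le> N"
  shows "window_energy (t + \<sigma>) \<le> window_energy t + window_energy (t + N)"
proof -
  have "window_energy (t + \<sigma>) \<le> (LINT w|lborel. indicator {t..t + N} w * (b w)\<^sup>2 + indicator {t + N..t + N + N} w * (b w)\<^sup>2)"
    unfolding window_energy_def
    by (intro integral_mono Bochner_Integration.integrable_add b_square_integrable)
       (use assms in \<open>auto split: split_indicator\<close>)
  also have "\<dots> = window_energy t + window_energy (t + N)"
    unfolding window_energy_def by (intro Bochner_Integration.integral_add b_square_integrable)
  finally show ?thesis .
qed

text \<open>Every window starting in between is covered by the two at \<open>t\<close> and
  \<open>t + N\<close>. Integrating the inflow bound thus gives a quarter of their sum, which can be
  solved for the later window with factor 1/3.\<close>

lemma window_energy_contraction: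
  assumes "0 \<le> t"
  shows "window_energy (t + N) \<le> window_energy t / 2"
proof -
  let ?c = "(window_energy t + window_energy (t + N)) / (4 * N)"
  have "window_energy (t + N) = (LINT \<sigma>|lborel. indicator {0..N} \<sigma> * (b (t + N + \<sigma>))\<^sup>2)"
    by (rule window_energy_shift)
  also have "\<dots> \<le> (LINT \<sigma>|lborel. ?c * indicator {0..N} \<sigma>)"
  proof (rule integral_mono_AE)
    show "AE \<sigma> in lborel. indicator {0..N} \<sigma> * (b (t + N + \<sigma>))\<^sup>2 \<le> ?c * indicator {0..N} \<sigma>"
      \<comment> \<open>The inflow bound needs positive time; dropping \<open>\<sigma> = 0\<close>
        admits \<open>t = 0\<close>.\<close>
      using AE_lborel_singleton[of 0]
    proof eventually_elim
      case (elim \<sigma>)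
      show ?case
      proof (cases "\<sigma> \<in> {0..N}")
        case True
        then have "(b (t + \<sigma> + N))\<^sup>2 \<le> window_energy (t + \<sigma>) / (4 * N)"
          using elim assms by (intro inflow_square_le) auto
        also have "\<dots> \<le> ?c"
          using window_energy_le_two_windows[of \<sigma> t] True N_pos by (intro divide_right_mono) auto
        finally show ?thesis using True by (simp add: add_ac)
      qed simp
    qed
  qed (rule b_shift_integrable integrable_mult_right integrable_indicator_Icc)+
  also have "\<dots> = (window_energy t + window_energy (t + N)) / 4" using N_pos by simp
  finally show ?thesis using window_energy_nonneg[of t] by simp
qed

text \<open>The inner factor 2 covers the start: a window starting in \<open>[0, N]\<close> lies in
  the first two, whose energies sum to at most 3/2 of the first.\<close>

lemma window_energy_decay:
  assumes "0 \<le> t"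
  shows "window_energy t \<le> 2 * exp (- (ln 2 / N) * t) * (2 * window_energy 0)"
proof (rule geometric_window_decay[where \<beta> = window_energy, OF N_pos window_energy_nonneg window_energy_contraction _ assms])
  fix r assume "0 \<le> r" "r \<le> N"
  then show "window_energy r \<le> 2 * window_energy 0"
    using window_energy_le_two_windows[of r 0] window_energy_contraction[of 0] window_energy_nonneg[of 0] by simp
qed

text \<open>The leading 4 is the rounding factor 2 of the geometric decay times the factor 2 for the
  starting windows; the two brackets are the constants of the norm equivalence.\<close>

lemma energy_decay:
  assumes "0 \<le> t"
  shows "energy t \<le> 4 * (2 + 2 * (\<mu> + \<kappa> * Cx)\<^sup>2 * N + 1 / h + 1 / (\<tau> - h))
      * (2 + 4 * \<kappa>\<^sup>2 + (1 + 4 * \<mu>\<^sup>2 * \<tau>) * \<tau>) * exp (- (ln 2 / N) * t) * energy 0"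
proof -
  let ?a = "2 + 2 * (\<mu> + \<kappa> * Cx)\<^sup>2 * N + 1 / h + 1 / \<eta>" and ?b = "2 + 4 * \<kappa>\<^sup>2 + (1 + 4 * \<mu>\<^sup>2 * \<tau>) * \<tau>"
  let ?e = "exp (- (ln 2 / N) * t)"
  have ring: "k * (2 * e * (2 * (l * s))) = 4 * k * l * e * s" for k l e s :: real by simp
  have a: "0 \<le> ?a" using N_pos h_pos \<eta>_pos by simp
  have "energy t \<le> ?a * window_energy t" by (rule energy_le_window_energy[OF assms])
  also have "\<dots> \<le> ?a * (2 * ?e * (2 * window_energy 0))" by (rule mult_left_mono[OF window_energy_decay[OF assms] a])
  also have "\<dots> \<le> ?a * (2 * ?e * (2 * (?b * energy 0)))"
    using window_energy_le_S[of 0] a by (intro mult_left_mono) auto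
  also have "\<dots> = 4 * ?a * ?b * ?e * energy 0" by (rule ring)
  finally show ?thesis by (simp only: \<eta>_def)
qed

end

theorem theorem6:
  fixes \<tau> h :: real and f K :: "real \<Rightarrow> real \<Rightarrow> real" and c :: "real \<Rightarrow> real"
  assumes "0 < h" and "h < \<tau>"
    and "C1_on2 T1 f" and "C_under c"
    and "kernel_K \<tau> f c K"
  shows "\<exists>\<epsilon>s>0. \<forall>\<epsilon>. 0 < \<epsilon> \<and> \<epsilon> < \<epsilon>s \<longrightarrow>
     (\<forall>Kh Lh Jh.
        continuous_on T1 (\<lambda>p. Kh (fst p) (snd p)) \<and>
        continuous_on {0..h} Lh \<and> continuous_on {0..\<tau> - h} Jh \<and>
        (\<forall>q\<in>{0..1}. \<bar>K 0 q - Kh 0 q\<bar> \<le> \<epsilon>) \<and>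
        (\<forall>\<phi>\<in>{0..h}. \<bar>kernel_L h \<tau> c K \<phi> - Lh \<phi>\<bar> \<le> \<epsilon>) \<and>
        (\<forall>\<sigma>\<in>{0..\<tau> - h}. \<bar>kernel_J c K \<sigma> - Jh \<sigma>\<bar> \<le> \<epsilon>)
        \<longrightarrow>
        (\<exists>W0>0. \<exists>\<alpha>0>0. \<forall>x0 v0 u0 x v u.
           L2_01 x0 \<and> L2_01 v0 \<and> L2_01 u0 \<and>
           closed_loop_solution h \<tau> f c Kh Lh Jh x0 v0 u0 x v u \<longrightarrow>
           (\<forall>t>0. L2norm2 (\<lambda>s. x s t) + L2norm2 (\<lambda>s. v s t) + L2norm2 (\<lambda>s. u s t)
                  \<le> W0 * exp (- \<alpha>0 * t) * (L2norm2 x0 + L2norm2 v0 + L2norm2 u0))))"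
proof -
  have "continuous_on T1 (\<lambda>p. f (fst p) (snd p))"
    using assms(3) unfolding C1_on2_def continuous_on_eq_continuous_within
    by (blast intro: has_derivative_continuous)
  moreover have "continuous_on {0..1} c" "c 1 = 0"
    using assms(4) unfolding C_under_def C1_on01_def continuous_on_eq_continuous_within
    by (blast intro: DERIV_continuous)+
  ultimately interpret plant h \<tau> f K c
    using assms by unfold_locales
  \<comment> \<open>The constant of \<open>energy_decay\<close>. It involves the plant alone, so the
    same amplitude and rate serve every \<open>\<epsilon>\<close> below the threshold and all
    approximate kernels.\<close>
  define W where "W = 4 * (2 + 2 * (\<mu> + \<kappa> * Cx)\<^sup>2 * N + 1 / h + 1 / (\<tau> - h))
      * (2 + 4 * \<kappa>\<^sup>2 + (1 + 4 * \<mu>\<^sup>2 * \<tau>) * \<tau>)"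
  \<comment> \<open>The value for which the smallness condition \<open>\<epsilon>_small\<close>
    becomes an equality.\<close>
  define \<epsilon>s where "\<epsilon>s = 1 / (2 * (1 + Cx) * N)"
  have "0 < \<epsilon>s" using Cx_pos N_pos by (simp add: \<epsilon>s_def)
  have "0 < W"
    unfolding W_def using N_pos \<tau>_pos assms(1,2)
    by (intro mult_pos_pos add_pos_nonneg) auto
  have "0 < ln 2 / N" using N_pos by simp
  have decay: "L2norm2 (\<lambda>s. x s t) + L2norm2 (\<lambda>s. v s t) + L2norm2 (\<lambda>s. u s t)
      \<le> W * exp (- (ln 2 / N) * t) * (L2norm2 x0 + L2norm2 v0 + L2norm2 u0)"
    if "0 < \<epsilon>" "\<epsilon> < \<epsilon>s" "continuous_on T1 (\<lambda>p. Kh (fst p) (snd p))"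
      "continuous_on {0..h} Lh" "continuous_on {0..\<tau> - h} Jh"
      "\<forall>q\<in>{0..1}. \<bar>K 0 q - Kh 0 q\<bar> \<le> \<epsilon>"
      "\<forall>\<phi>\<in>{0..h}. \<bar>kernel_L h \<tau> c K \<phi> - Lh \<phi>\<bar> \<le> \<epsilon>"
      "\<forall>\<sigma>\<in>{0..\<tau> - h}. \<bar>kernel_J c K \<sigma> - Jh \<sigma>\<bar> \<le> \<epsilon>"
      "closed_loop_solution h \<tau> f c Kh Lh Jh x0 v0 u0 x v u" "0 < t"
    for \<epsilon> Kh Lh Jh x0 v0 u0 x v u t
  proof -
    have "\<epsilon> * (2 * (1 + Cx) * N) \<le> \<epsilon>s * (2 * (1 + Cx) * N)"
      using that(2) Cx_pos N_pos by (intro mult_right_mono) auto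
    also have "\<dots> = 1" using Cx_pos N_pos by (simp add: \<epsilon>s_def)
    finally interpret approximate_feedback h \<tau> f K c Kh Lh Jh x0 v0 u0 x v u \<epsilon>
      using that by unfold_locales auto
    show ?thesis using energy_decay[of t] that(10) unfolding energy_0 W_def unfolding energy_def by simp
  qed
  show ?thesis
    by (rule exI[of _ \<epsilon>s], rule conjI[OF \<open>0 < \<epsilon>s\<close>], intro allI impI, elim conjE,
        rule exI[of _ W], rule conjI[OF \<open>0 < W\<close>],
        rule exI[of _ "ln 2 / N"], rule conjI[OF \<open>0 < ln 2 / N\<close>], intro allI impI, elim conjE, rule decay)
qed

end
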